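(* Let $(\Omega,I,J,g,q)$ be a finite zero-sum state-blind stochastic game, where $q$ is its kernel, and let $\lambda>0$. For a partition $T_\infty$ of $[0,+\infty)$ with stage durations $h_1,h_2,\ldots$, let $v_{T_\infty,\lambda}:\Delta(\Omega)\to\mathbb R$ be the value of the $\lambda$-discounted state-blind game with $n$-th stage duration $h_n$. Then the uniform limit (uniform in $p\in\Delta(\Omega)$) of $v_{T_\infty,\lambda}(p)$ as $\sup_i h_i\to0$ (over partitions of $[0,+\infty)$, so $h_1+h_2+\cdots=+\infty$) exists, and it is the unique (continuous) viscosity solution of the partial differential equation $$\lambda v(p)=\mathrm{Val}_{I\times J}\Big[\lambda\, g(i,j,p)+\langle p*q(i,j),\nabla v(p)\rangle\Big],\qquad p\in\Delta(\Omega).$$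
   Context: **Game.** $\Omega, I, J$ are finite nonempty sets (states, actions of player 1, actions of player 2), $g:I\times J\times\Omega\to\mathbb R$ is the payoff function of player 1, and the kernel $q$ assigns to each $(i,j)$ an $|\Omega|\times|\Omega|$ matrix $q(i,j)=P(i,j)-\mathrm{Id}$ with $P(i,j)$ row-stochastic. $\Delta(C)$ is the set of probability measures on a finite set $C$. For $p\in\Delta(\Omega)$: $g(i,j,p)=\sum_\omega p(\omega)g(i,j,\omega)$, and for a matrix $\mu$, $(p*\mu)(\omega)=\sum_{\omega'}p(\omega')\mu_{\omega'\omega}$. $\langle\cdot,\cdot\rangle$ is the standard inner product on $\mathbb R^\Omega$, and $\mathrm{Val}_{I\times J}[a(i,j)]=\sup_{x\in\Delta(I)}\inf_{y\in\Delta(J)}\sum_{i,j}x(i)y(j)a(i,j)$ (which equals the corresponding $\inf\sup$). **Partitions.** A partition $T_\infty$ of $[0,+\infty)$ is a strictly increasing sequence $(t_n)_{n\ge1}$ with $t_1=0$ and $t_n\to+\infty$; $h_n=t_{n+1}-t_n$. Only partitions with $\sup_n h_n\le1$ matter. **Discounted state-blind game with stage duration.** The initial state $\omega_1$ is drawn from $p\in\Delta(\Omega)$, with $p$ known to both players. At each stage $m\ge1$, the players do not observe the state (or the payoffs), but remember all past actions; they simultaneously choose mixed actions in $\Delta(I)$ and $\Delta(J)$, actions $i_m,j_m$ are drawn independently and publicly observed, and $\omega_{m+1}$ is drawn from the law $(\mathrm{Id}+h_m q(i_m,j_m))(\omega_m,\cdot)$. (Behavior) strategies are maps from finite sequences of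 past action pairs to $\Delta(I)$, $\Delta(J)$. Player 1 maximizes and player 2 minimizes $E^{p}_{\sigma,\tau}\big(\sum_{m\ge1}h_m\lambda e^{-\lambda t_m}g(i_m,j_m,\omega_m)\big)$. The value ($\sup_\sigma\inf_\tau=\inf_\tau\sup_\sigma$) exists and is denoted $v_{T_\infty,\lambda}(p)$. **Uniform limit.** "The uniform limit is $v$" means: for every $\varepsilon>0$ there is $\delta>0$ such that for every partition $T_\infty$ of $[0,+\infty)$ with $\sup_i h_i\le\delta$, $\sup_{p\in\Delta(\Omega)}|v_{T_\infty,\lambda}(p)-v(p)|\le\varepsilon$. **Viscosity solution.** A function $u:\Delta(\Omega)\to\mathbb R$ is a viscosity solution of the equation if, for every $C^1$ function $\psi:\Delta(\Omega)\to\mathbb R$ (restriction of a $C^1$ function on a neighborhood in $\mathbb R^\Omega$): (1) whenever $u-\psi$ has a strict local maximum, relative to $\Delta(\Omega)$, at $\bar p\in\Delta(\Omega)$, $\lambda u(\bar p)\le\mathrm{Val}_{I\times J}[\lambda g(i,j,\bar p)+\langle\bar p*q(i,j),\nabla\psi(\bar p)\rangle]$; (2) whenever $u-\psi$ has a strict local minimum, relative to $\Delta(\Omega)$, at $\bar p\in\Delta(\Omega)$, $\lambda u(\bar p)\ge\mathrm{Val}_{I\times J}[\lambda g(i,j,\bar p)+\langle\bar p*q(i,j),\nabla\psi(\bar p)\rangle]$. *)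

theory Defs
  imports "HOL-Probability.Probability"
begin

section \<open>Simplex, stochastic matrices, value of a finite matrix game\<close>

text \<open>
  States, actions of player 1 and actions of player 2 are the elements of types
  \<open>'w\<close>, \<open>'i\<close>, \<open>'j\<close> of class \<open>finite\<close>. Beliefs over states are vectors,
  since the equation lives on a subset of a Euclidean space; mixed actions are \<open>pmf\<close>s.
\<close>

definition prob_simplex :: "(real ^ 'w) set" where
  "prob_simplex = {p. (\<forall>\<omega>. 0 \<le> p $ \<omega>) \<and> (\<Sum>\<omega>\<in>UNIV. p $ \<omega>) = 1}"

definition row_stochastic :: "real ^ 'w ^ 'w \<Rightarrow> bool" where
  "row_stochastic A \<longleftrightarrow> (\<forall>\<omega>. row \<omega> A \<in> prob_simplex)"

definition vec_pmf :: "real ^ 'w \<Rightarrow> 'w pmf" where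
  "vec_pmf p = embed_pmf (\<lambda>\<omega>. p $ \<omega>)"

definition mean_payoff :: "('i \<Rightarrow> 'j \<Rightarrow> 'w \<Rightarrow> real) \<Rightarrow> 'i \<Rightarrow> 'j \<Rightarrow> real ^ 'w \<Rightarrow> real" where
  "mean_payoff g i j p = (\<Sum>\<omega>\<in>UNIV. p $ \<omega> * g i j \<omega>)"

definition Val :: "('i::finite \<Rightarrow> 'j::finite \<Rightarrow> real) \<Rightarrow> real" where
  "Val a = (SUP x :: 'i pmf. INF y :: 'j pmf.
     (\<Sum>i\<in>UNIV. \<Sum>j\<in>UNIV. pmf x i * pmf y j * a i j))"

section \<open>Partitions\<close>

text \<open>Sequences are indexed from 0: \<open>t n\<close> and \<open>stage_dur t n\<close> are the starting time and the
  duration of the \<open>(n+1)\<close>-st stage.\<close>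

definition time_partition :: "(nat \<Rightarrow> real) \<Rightarrow> bool" where
  "time_partition t \<longleftrightarrow> t 0 = 0 \<and> strict_mono t \<and> filterlim t at_top sequentially"

definition stage_dur :: "(nat \<Rightarrow> real) \<Rightarrow> nat \<Rightarrow> real" where
  "stage_dur t n = t (Suc n) - t n"

section \<open>The discounted state-blind game\<close>

text \<open>A strategy only sees the list of past action pairs, oldest first.\<close>

type_synonym ('i, 'j) strategy1 = "('i \<times> 'j) list \<Rightarrow> 'i pmf"
type_synonym ('i, 'j) strategy2 = "('i \<times> 'j) list \<Rightarrow> 'j pmf"

text \<open>A play assigns to each stage the triple (state, action of player 1, action of player 2).\<close>

definition action_hist :: "(nat \<Rightarrow> 'w \<times> 'i \<times> 'j) \<Rightarrow> nat \<Rightarrow> ('i \<times> 'j) list" where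
  "action_hist \<xi> n = map (\<lambda>k. snd (\<xi> k)) [0..<n]"

text \<open>Rows of \<open>mat 1 + h *\<^sub>R q i j\<close> are probability vectors only for \<open>0 \<le> h \<le> 1\<close>
  (\<open>row_stochastic_duration\<close> below); for other \<open>h\<close> the law is unspecified.\<close>

definition state_law ::
  "(nat \<Rightarrow> real) \<Rightarrow> ('i \<Rightarrow> 'j \<Rightarrow> real ^ 'w ^ 'w) \<Rightarrow> real ^ 'w \<Rightarrow>
     nat \<Rightarrow> (nat \<Rightarrow> 'w \<times> 'i \<times> 'j) \<Rightarrow> 'w pmf" where
  "state_law t q p n \<xi> = (case n of
      0 \<Rightarrow> vec_pmf p
    | Suc m \<Rightarrow> (case \<xi> m of (\<omega>, i, j) \<Rightarrow> vec_pmf (row \<omega> (mat 1 + stage_dur t m *\<^sub>R q i j))))"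

definition stage_law ::
  "(nat \<Rightarrow> real) \<Rightarrow> ('i \<Rightarrow> 'j \<Rightarrow> real ^ 'w ^ 'w) \<Rightarrow> real ^ 'w \<Rightarrow>
     ('i, 'j) strategy1 \<Rightarrow> ('i, 'j) strategy2 \<Rightarrow>
     nat \<Rightarrow> (nat \<Rightarrow> 'w \<times> 'i \<times> 'j) \<Rightarrow> ('w \<times> 'i \<times> 'j) pmf" where
  "stage_law t q p \<sigma> \<tau> n \<xi> =
     pair_pmf (state_law t q p n \<xi>)
       (pair_pmf (\<sigma> (action_hist \<xi> n)) (\<tau> (action_hist \<xi> n)))"

text \<open>The law of the play is the Ionescu-Tulcea measure of these kernels
  (see \<open>Ionescu_Tulcea_stage_law\<close> below).\<close>

definition play_measure ::
  "(nat \<Rightarrow> real) \<Rightarrow> ('i \<Rightarrow> 'j \<Rightarrow> real ^ 'w ^ 'w) \<Rightarrow> real ^ 'w \<Rightarrow>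
     ('i, 'j) strategy1 \<Rightarrow> ('i, 'j) strategy2 \<Rightarrow> (nat \<Rightarrow> 'w \<times> 'i \<times> 'j) measure" where
  "play_measure t q p \<sigma> \<tau> =
     projective_family.lim UNIV
       (Ionescu_Tulcea.CI (\<lambda>n \<xi>. measure_pmf (stage_law t q p \<sigma> \<tau> n \<xi>)) (\<lambda>_. count_space UNIV))
       (\<lambda>_. count_space UNIV)"

definition discounted_payoff ::
  "(nat \<Rightarrow> real) \<Rightarrow> real \<Rightarrow> ('i \<Rightarrow> 'j \<Rightarrow> 'w \<Rightarrow> real) \<Rightarrow> (nat \<Rightarrow> 'w \<times> 'i \<times> 'j) \<Rightarrow> real" where
  "discounted_payoff t lam g \<xi> =
     (\<Sum>n. stage_dur t n * lam * exp (- lam * t n) * (case \<xi> n of (\<omega>, i, j) \<Rightarrow> g i j \<omega>))"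

definition expected_payoff ::
  "(nat \<Rightarrow> real) \<Rightarrow> real \<Rightarrow> ('i \<Rightarrow> 'j \<Rightarrow> 'w \<Rightarrow> real) \<Rightarrow> ('i \<Rightarrow> 'j \<Rightarrow> real ^ 'w ^ 'w) \<Rightarrow>
     real ^ 'w \<Rightarrow> ('i, 'j) strategy1 \<Rightarrow> ('i, 'j) strategy2 \<Rightarrow> real" where
  "expected_payoff t lam g q p \<sigma> \<tau> =
     (\<integral>\<xi>. discounted_payoff t lam g \<xi> \<partial>play_measure t q p \<sigma> \<tau>)"

text \<open>The game has a value, so the infimum and the supremum could be exchanged.\<close>

definition game_value ::
  "(nat \<Rightarrow> real) \<Rightarrow> real \<Rightarrow> ('i \<Rightarrow> 'j \<Rightarrow> 'w \<Rightarrow> real) \<Rightarrow> ('i \<Rightarrow> 'j \<Rightarrow> real ^ 'w ^ 'w) \<Rightarrow>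
     real ^ 'w \<Rightarrow> real" where
  "game_value t lam g q p =
     (SUP \<sigma> :: ('i, 'j) strategy1. INF \<tau> :: ('i, 'j) strategy2. expected_payoff t lam g q p \<sigma> \<tau>)"

definition is_uniform_limit ::
  "real \<Rightarrow> ('i \<Rightarrow> 'j \<Rightarrow> 'w \<Rightarrow> real) \<Rightarrow> ('i \<Rightarrow> 'j \<Rightarrow> real ^ 'w ^ 'w) \<Rightarrow>
     (real ^ 'w \<Rightarrow> real) \<Rightarrow> bool" where
  "is_uniform_limit lam g q v \<longleftrightarrow>
     (\<forall>\<epsilon>>0. \<exists>\<delta>>0. \<forall>t. time_partition t \<and> (\<forall>n. stage_dur t n \<le> \<delta>) \<longrightarrow>
        (\<forall>p\<in>prob_simplex. \<bar>game_value t lam g q p - v p\<bar> \<le> \<epsilon>))"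

section \<open>Viscosity solutions\<close>

definition C1_near_simplex :: "(real ^ 'w \<Rightarrow> real) \<Rightarrow> (real ^ 'w \<Rightarrow> real ^ 'w) \<Rightarrow> bool" where
  "C1_near_simplex \<psi> D\<psi> \<longleftrightarrow>
     (\<exists>U. open U \<and> prob_simplex \<subseteq> U \<and> (\<forall>x\<in>U. GDERIV \<psi> x :> D\<psi> x) \<and> continuous_on U D\<psi>)"

definition strict_local_max_on :: "'a::topological_space set \<Rightarrow> ('a \<Rightarrow> real) \<Rightarrow> 'a \<Rightarrow> bool" where
  "strict_local_max_on S f x \<longleftrightarrow> x \<in> S \<and> (\<forall>\<^sub>F y in at x within S. f y < f x)"

definition strict_local_min_on :: "'a::topological_space set \<Rightarrow> ('a \<Rightarrow> real) \<Rightarrow> 'a \<Rightarrow> bool" where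
  "strict_local_min_on S f x \<longleftrightarrow> x \<in> S \<and> (\<forall>\<^sub>F y in at x within S. f y > f x)"

text \<open>\<open>p v* A\<close> is the product of the row vector \<open>p\<close> with the matrix \<open>A\<close>.\<close>

definition hamiltonian ::
  "real \<Rightarrow> ('i::finite \<Rightarrow> 'j::finite \<Rightarrow> 'w \<Rightarrow> real) \<Rightarrow> ('i \<Rightarrow> 'j \<Rightarrow> real ^ 'w ^ 'w) \<Rightarrow>
     real ^ 'w \<Rightarrow> real ^ 'w \<Rightarrow> real" where
  "hamiltonian lam g q p z = Val (\<lambda>i j. lam * mean_payoff g i j p + (p v* q i j) \<bullet> z)"

definition viscosity_solution ::
  "real \<Rightarrow> ('i::finite \<Rightarrow> 'j::finite \<Rightarrow> 'w \<Rightarrow> real) \<Rightarrow> ('i \<Rightarrow> 'j \<Rightarrow> real ^ 'w ^ 'w) \<Rightarrow>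
     (real ^ 'w \<Rightarrow> real) \<Rightarrow> bool" where
  "viscosity_solution lam g q u \<longleftrightarrow>
     (\<forall>\<psi> D\<psi>. C1_near_simplex \<psi> D\<psi> \<longrightarrow>
        (\<forall>p. strict_local_max_on prob_simplex (\<lambda>x. u x - \<psi> x) p \<longrightarrow>
               lam * u p \<le> hamiltonian lam g q p (D\<psi> p)) \<and>
        (\<forall>p. strict_local_min_on prob_simplex (\<lambda>x. u x - \<psi> x) p \<longrightarrow>
               lam * u p \<ge> hamiltonian lam g q p (D\<psi> p)))"

section \<open>Well-definedness\<close>

lemma pmf_vec_pmf:
  fixes p :: "real ^ 'w::finite"
  assumes "p \<in> prob_simplex"
  shows "pmf (vec_pmf p) \<omega> = p $ \<omega>"
proof -
  have "(\<integral>\<^sup>+ \<omega>. ennreal (p $ \<omega>) \<partial>count_space UNIV) = 1"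
    using assms by (simp add: prob_simplex_def nn_integral_count_space_finite sum_ennreal)
  then show ?thesis
    using assms unfolding vec_pmf_def by (subst pmf_embed_pmf) (auto simp: prob_simplex_def)
qed

lemma row_stochastic_duration:
  fixes A :: "real ^ 'w::finite ^ 'w"
  assumes "row_stochastic A" "0 \<le> h" "h \<le> 1"
  shows "row_stochastic (mat 1 + h *\<^sub>R (A - mat 1))"
  unfolding row_stochastic_def prob_simplex_def
proof (intro allI CollectI conjI)
  fix \<omega> \<omega>' :: 'w
  have A: "0 \<le> A $ \<omega> $ \<omega>'" "(\<Sum>k\<in>UNIV. A $ \<omega> $ k) = 1" for \<omega> \<omega>'
    using assms(1) by (auto simp: row_stochastic_def prob_simplex_def row_def)
  show "0 \<le> row \<omega> (mat 1 + h *\<^sub>R (A - mat 1)) $ \<omega>'"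
  proof -
    have "row \<omega> (mat 1 + h *\<^sub>R (A - mat 1)) $ \<omega>' =
        (1 - h) * (if \<omega> = \<omega>' then 1 else 0) + h * A $ \<omega> $ \<omega>'"
      by (simp add: row_def mat_def algebra_simps)
    then show ?thesis
      using assms(2,3) A(1)[of \<omega> \<omega>'] by simp
  qed
  show "(\<Sum>k\<in>UNIV. row \<omega> (mat 1 + h *\<^sub>R (A - mat 1)) $ k) = 1"
    using A(2)[of \<omega>]
    by (simp add: row_def mat_def sum.distrib sum_subtractf flip: sum_distrib_left)
qed

lemma Ionescu_Tulcea_stage_law:
  fixes q :: "'i::finite \<Rightarrow> 'j::finite \<Rightarrow> real ^ 'w::finite ^ 'w"
  shows "Ionescu_Tulcea (\<lambda>n \<xi>. measure_pmf (stage_law t q p \<sigma> \<tau> n \<xi>)) (\<lambda>_. count_space UNIV)"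
proof
  fix n :: nat
  let ?X = "PiM {0..<n} (\<lambda>_. count_space (UNIV :: ('w \<times> 'i \<times> 'j) set))"
  have X: "?X = count_space ({0..<n} \<rightarrow>\<^sub>E UNIV)"
    by (rule count_space_PiM_finite) auto
  show "(\<lambda>\<xi>. measure_pmf (stage_law t q p \<sigma> \<tau> n \<xi>)) \<in> ?X \<rightarrow>\<^sub>M subprob_algebra (count_space UNIV)"
    unfolding X by (auto simp: space_subprob_algebra intro: measure_pmf.subprob_space_axioms)
qed

lemma prob_space_play_measure:
  fixes q :: "'i::finite \<Rightarrow> 'j::finite \<Rightarrow> real ^ 'w::finite ^ 'w"
  shows "prob_space (play_measure t q p \<sigma> \<tau>)"
    and "sets (play_measure t q p \<sigma> \<tau>) = sets (PiM UNIV (\<lambda>_. count_space UNIV))"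
proof -
  interpret IT: Ionescu_Tulcea "\<lambda>n \<xi>. measure_pmf (stage_law t q p \<sigma> \<tau> n \<xi>)" "\<lambda>_. count_space UNIV"
    by (rule Ionescu_Tulcea_stage_law)
  show sets: "sets (play_measure t q p \<sigma> \<tau>) = sets (PiM UNIV (\<lambda>_. count_space UNIV))"
    unfolding play_measure_def by (rule IT.PF.sets_lim)
  have "emeasure (play_measure t q p \<sigma> \<tau>)
      (prod_emb UNIV (\<lambda>_. count_space UNIV) {} {\<lambda>_. undefined}) = emeasure (IT.CI {}) {\<lambda>_. undefined}"
    unfolding play_measure_def by (rule IT.lim) (auto simp: sets_PiM_empty)
  also have "\<dots> = 1"
    using prob_space.emeasure_space_1[OF IT.PF.prob_space_P[of "{}"]] IT.PF.space_P[of "{}"]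
    by (simp add: space_PiM_empty)
  finally show "prob_space (play_measure t q p \<sigma> \<tau>)"
    by (intro prob_spaceI) (simp add: sets_eq_imp_space_eq[OF sets] prod_emb_def space_PiM PiE_def restrict_def)
qed

lemma measurable_discounted_payoff:
  fixes g :: "'i::finite \<Rightarrow> 'j::finite \<Rightarrow> 'w::finite \<Rightarrow> real"
  shows "discounted_payoff t lam g \<in> borel_measurable (PiM UNIV (\<lambda>_. count_space UNIV))"
proof -
  have [measurable]: "(\<lambda>\<xi>. \<xi> n) \<in> PiM UNIV (\<lambda>_. count_space UNIV) \<rightarrow>\<^sub>M count_space (UNIV :: ('w \<times> 'i \<times> 'j) set)"
    for n :: nat by (rule measurable_component_singleton) simp
  show ?thesis
    unfolding discounted_payoff_def by measurable
qed

end

theory Submission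
  imports Defs
begin

text \<open>
  For fixed strategies the expected payoff is a linear function of the initial belief, because the
  strategies do not see the state; hence the values are Lipschitz in the belief, uniformly in the
  partition. They satisfy a Bellman equation relating a partition to its tail. The limit, as the
  mesh tends to 0, of the supremum of the values over all partitions is therefore a continuous
  viscosity subsolution; exchanging the roles of the players, the limit of the infimum is a
  supersolution. Comparison shows that the two limits agree, which gives uniform convergence,
  existence and uniqueness at once.
\<close>

section \<open>The expected payoff as a discounted series\<close>

text \<open>The Bellman equation links the value for a partition to the value for its tail, which is
  a different function of the belief, so a test function cannot simply be inserted into a
  fixed-point equation. The remedy is to treat all tails of one partition at once and to maximise
  over stage and belief together; the tails are as fine as the partition, so the upper limit
  controls all of them. The suprema at different beliefs may be approached along different
  partitions; a Lipschitz constant common to all partitions is what makes their limit continuous.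
  Exchanging the players turns sup inf into inf sup. The limit argument is therefore run for every
  operator \<open>V\<close> that is monotone, commutes with adding constants and is positively
  homogeneous, a class closed under passing to
  \<open>\<lambda>a. - V (\<lambda>i j. - a i j)\<close>. Contact points on the boundary of the
  simplex are treated like all others, because a stage of duration at most 1 maps beliefs to
  beliefs.\<close>

lemma integral_play_measure_step:
  fixes q :: "'i::finite \<Rightarrow> 'j::finite \<Rightarrow> real ^ 'w::finite ^ 'w"
    and F :: "(nat \<Rightarrow> 'w \<times> 'i \<times> 'j) \<Rightarrow> real"
  assumes F: "\<And>\<xi> \<xi>'. (\<And>k. k \<le> n \<Longrightarrow> \<xi> k = \<xi>' k) \<Longrightarrow> F \<xi> = F \<xi>'"
  shows "(\<integral>\<xi>. F \<xi> \<partial>play_measure t q p \<sigma> \<tau>) =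
    (\<integral>\<xi>. (\<integral>x. F (\<xi>(n := x)) \<partial>measure_pmf (stage_law t q p \<sigma> \<tau> n \<xi>)) \<partial>play_measure t q p \<sigma> \<tau>)"
proof -
  interpret IT: Ionescu_Tulcea "\<lambda>n \<xi>. measure_pmf (stage_law t q p \<sigma> \<tau> n \<xi>)" "\<lambda>_. count_space UNIV"
    by (rule Ionescu_Tulcea_stage_law)
  let ?M = "\<lambda>m::nat. PiM {0..<m} (\<lambda>_. count_space (UNIV :: ('w \<times> 'i \<times> 'j) set))"
  let ?L = "play_measure t q p \<sigma> \<tau>"
  have M: "?M m = count_space ({0..<m} \<rightarrow>\<^sub>E UNIV)" for m
    by (rule count_space_PiM_finite) auto
  have fin: "finite ({0..<m} \<rightarrow>\<^sub>E (UNIV :: ('w \<times> 'i \<times> 'j) set))" for m :: nat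
    by (rule finite_PiE) auto
  have up: "IT.up_to {0..<m} = m" for m
    using IT.up_to_iff[of "{0..<m}" m] IT.up_to_less[of "{0..<m}" "m - 1"] by (cases m) auto
  have CI: "IT.CI {0..<m} = IT.C 0 m (\<lambda>_. undefined)" for m
    using IT.distr_C[of m m "\<lambda>_. undefined" 0] by (simp add: IT.CI_def up space_PiM)
  \<comment> \<open>A function of the first \<open>m\<close> stages sees only the finite-stage
    marginal. There the space of plays is finite, so measurability and boundedness are
    automatic.\<close>
  have lim: "(\<integral>\<xi>. G \<xi> \<partial>?L) = (\<integral>\<xi>. G \<xi> \<partial>IT.C 0 m (\<lambda>_. undefined))"
    if G: "\<And>\<xi> \<xi>'. (\<And>k. k < m \<Longrightarrow> \<xi> k = \<xi>' k) \<Longrightarrow> G \<xi> = (G \<xi>' :: real)" for G m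
  proof -
    have "(\<integral>\<xi>. G \<xi> \<partial>?L) = (\<integral>\<xi>. G (restrict \<xi> {0..<m}) \<partial>?L)"
      by (intro Bochner_Integration.integral_cong G) auto
    also have "\<dots> = (\<integral>\<xi>. G \<xi> \<partial>distr ?L (?M m) (\<lambda>\<xi>. restrict \<xi> {0..<m}))"
    proof (rule integral_distr[symmetric])
      show "(\<lambda>\<xi>. restrict \<xi> {0..<m}) \<in> ?L \<rightarrow>\<^sub>M ?M m"
        unfolding measurable_cong_sets[OF prob_space_play_measure(2) refl]
        by (rule measurable_restrict_subset) simp
      show "G \<in> borel_measurable (?M m)"
        unfolding M by simp
    qed
    also have "\<dots> = (\<integral>\<xi>. G \<xi> \<partial>IT.C 0 m (\<lambda>_. undefined))"
      using IT.distr_lim[of "{0..<m}"] by (simp add: play_measure_def CI)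
    finally show ?thesis .
  qed
  have sp: "space (IT.C 0 n (\<lambda>_. undefined)) = {0..<n} \<rightarrow>\<^sub>E UNIV"
    by (simp add: IT.space_C space_PiM)
  obtain B where B: "\<And>\<xi>. \<xi> \<in> {0..<Suc n} \<rightarrow>\<^sub>E UNIV \<Longrightarrow> \<bar>F \<xi>\<bar> \<le> B"
  proof
    fix \<xi> :: "nat \<Rightarrow> 'w \<times> 'i \<times> 'j" assume "\<xi> \<in> {0..<Suc n} \<rightarrow>\<^sub>E UNIV"
    then show "\<bar>F \<xi>\<bar> \<le> Max ((\<lambda>\<xi>. \<bar>F \<xi>\<bar>) ` ({0..<Suc n} \<rightarrow>\<^sub>E UNIV))"
      using fin by (intro Max_ge) auto
  qed
  have "(\<integral>\<xi>. F \<xi> \<partial>?L) = (\<integral>\<xi>. F \<xi> \<partial>IT.C 0 (Suc n) (\<lambda>_. undefined))"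
    by (rule lim) (auto intro!: F)
  also have "\<dots> = (\<integral>\<xi>. (\<integral>\<xi>'. F \<xi>' \<partial>IT.eP n \<xi>) \<partial>IT.C 0 n (\<lambda>_. undefined))"
  proof -
    have pC: "prob_space (IT.C 0 n (\<lambda>_. undefined))" by (rule IT.prob_space_C) simp
    have "(\<integral>\<xi>. F \<xi> \<partial>(IT.C 0 n (\<lambda>_. undefined) \<bind> IT.eP n)) =
      (\<integral>\<xi>. (\<integral>\<xi>'. F \<xi>' \<partial>IT.eP n \<xi>) \<partial>IT.C 0 n (\<lambda>_. undefined))"
    proof (rule integral_bind[where K = "?M (Suc n)" and B = B and B' = 1])
      show "F \<in> borel_measurable (?M (Suc n))" unfolding M by simp
      show "finite_measure (IT.C 0 n (\<lambda>_. undefined))"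
        using pC by (rule prob_space.finite_measure)
      show "IT.eP n \<in> IT.C 0 n (\<lambda>_. undefined) \<rightarrow>\<^sub>M subprob_algebra (?M (Suc n))"
        using IT.measurable_eP[of n] by (simp add: measurable_cong_sets[OF IT.sets_C refl])
      show "\<bar>F \<xi>\<bar> \<le> B" if "\<xi> \<in> space (?M (Suc n))" for \<xi>
        using that by (intro B) (simp add: space_PiM)
      show "AE \<xi> in IT.C 0 n (\<lambda>_. undefined). emeasure (IT.eP n \<xi>) (space (IT.eP n \<xi>)) \<le> ennreal 1"
      proof (rule AE_I2)
        fix \<xi> assume "\<xi> \<in> space (IT.C 0 n (\<lambda>_. undefined))"
        then have "prob_space (IT.eP n \<xi>)" by (intro IT.prob_space_eP) (simp add: IT.space_C)
        then show "emeasure (IT.eP n \<xi>) (space (IT.eP n \<xi>)) \<le> ennreal 1"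
          by (simp add: prob_space.emeasure_space_1)
      qed
    qed
    then show ?thesis by simp
  qed
  also have "\<dots> = (\<integral>\<xi>. (\<integral>x. F (\<xi>(n := x)) \<partial>measure_pmf (stage_law t q p \<sigma> \<tau> n \<xi>)) \<partial>IT.C 0 n (\<lambda>_. undefined))"
  proof (rule Bochner_Integration.integral_cong[OF refl])
    fix \<xi> assume "\<xi> \<in> space (IT.C 0 n (\<lambda>_. undefined))"
    then have \<xi>: "\<xi> \<in> {0..<n} \<rightarrow>\<^sub>E UNIV" by (simp add: sp)
    show "(\<integral>\<xi>'. F \<xi>' \<partial>IT.eP n \<xi>) = (\<integral>x. F (\<xi>(n := x)) \<partial>measure_pmf (stage_law t q p \<sigma> \<tau> n \<xi>))"
      unfolding IT.eP_def
    proof (rule integral_distr)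
      show "fun_upd \<xi> n \<in> measure_pmf (stage_law t q p \<sigma> \<tau> n \<xi>) \<rightarrow>\<^sub>M ?M (Suc n)"
        using \<xi> unfolding M by (auto simp: PiE_iff extensional_def)
      show "F \<in> borel_measurable (?M (Suc n))" unfolding M by simp
    qed
  qed
  \<comment> \<open>The way back to the full measure: the inner integral depends on the stages
    before \<open>n\<close> only, since the stage law reads nothing else.\<close>
  also have "\<dots> = (\<integral>\<xi>. (\<integral>x. F (\<xi>(n := x)) \<partial>measure_pmf (stage_law t q p \<sigma> \<tau> n \<xi>)) \<partial>?L)"
  proof (rule lim[symmetric])
    fix \<xi> \<xi>' :: "nat \<Rightarrow> 'w \<times> 'i \<times> 'j" assume eq: "\<And>k. k < n \<Longrightarrow> \<xi> k = \<xi>' k"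
    have "action_hist \<xi> n = action_hist \<xi>' n"
      using eq by (simp add: action_hist_def)
    then have "stage_law t q p \<sigma> \<tau> n \<xi> = stage_law t q p \<sigma> \<tau> n \<xi>'"
      using eq by (auto simp: stage_law_def state_law_def split: nat.split)
    moreover have "F (\<xi>(n := x)) = F (\<xi>'(n := x))" for x
      using eq by (intro F) auto
    ultimately show "(\<integral>x. F (\<xi>(n := x)) \<partial>measure_pmf (stage_law t q p \<sigma> \<tau> n \<xi>)) =
        (\<integral>x. F (\<xi>'(n := x)) \<partial>measure_pmf (stage_law t q p \<sigma> \<tau> n \<xi>'))"
      by simp
  qed
  finally show ?thesis .
qed

section \<open>Averages over mixed actions, and beliefs under stochastic matrices\<close>

definition mix :: "'i::finite pmf \<Rightarrow> 'j::finite pmf \<Rightarrow> ('i \<Rightarrow> 'j \<Rightarrow> 'a) \<Rightarrow> 'a::real_vector" where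
  "mix x y a = (\<Sum>i\<in>UNIV. \<Sum>j\<in>UNIV. (pmf x i * pmf y j) *\<^sub>R a i j)"

lemma sum_pmf_mult:
  fixes x :: "'i::finite pmf" and y :: "'j::finite pmf"
  shows "(\<Sum>i\<in>UNIV. \<Sum>j\<in>UNIV. pmf x i * pmf y j) = 1"
  by (simp add: sum_pmf_eq_1 flip: sum_distrib_left)

lemma mix_add: "mix x y (\<lambda>i j. a i j + b i j) = mix x y a + mix x y b"
  by (simp add: mix_def sum.distrib scaleR_add_right)

text \<open>This is why \<open>mix\<close> takes values in any real vector space: averages of
  vectors indexed by states pass through coordinates and through the inner product with a
  belief.\<close>

lemma mix_linear: "linear f \<Longrightarrow> f (mix x y a) = mix x y (\<lambda>i j. f (a i j))"
  by (simp add: mix_def linear_sum linear_scale)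

lemma mix_scaleR: "mix x y (\<lambda>i j. c *\<^sub>R a i j) = c *\<^sub>R mix x y a"
  by (simp add: mix_def scaleR_sum_right mult.commute)

lemma mix_mult: "mix x y (\<lambda>i j. c * a i j) = c * mix x y a" for a :: "_ \<Rightarrow> _ \<Rightarrow> real"
  using mix_scaleR[of x y c a] by simp

lemma mix_const: "mix x y (\<lambda>i j. c) = (c :: real)"
  unfolding mix_def real_scaleR_def sum_distrib_right[symmetric] sum_pmf_mult by simp

lemma mix_mono: "(\<And>i j. a i j \<le> b i j) \<Longrightarrow> mix x y a \<le> (mix x y b :: real)"
  by (auto simp: mix_def intro!: sum_mono mult_left_mono)

lemma mix_abs_le:
  assumes "\<And>i j. \<bar>a i j\<bar> \<le> (B :: real)" shows "\<bar>mix x y a\<bar> \<le> B"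
proof -
  have "mix x y a \<le> mix x y (\<lambda>_ _. B)" "mix x y (\<lambda>_ _. - B) \<le> mix x y a"
    using assms by (auto intro!: mix_mono simp: abs_le_iff minus_le_iff)
  then show ?thesis by (simp add: mix_const)
qed

lemma mix_sums:
  assumes "\<And>i j. (\<lambda>n. f n i j) sums (s i j)"
  shows "(\<lambda>n. mix x y (f n)) sums mix x y (s :: _ \<Rightarrow> _ \<Rightarrow> real)"
  unfolding mix_def by (intro sums_sum sums_scaleR_right assms)

lemma expectation_pair_pmf_mix:
  fixes F :: "'w::finite \<times> 'i::finite \<times> 'j::finite \<Rightarrow> real"
  shows "measure_pmf.expectation (pair_pmf a (pair_pmf x y)) F =
    (\<Sum>\<omega>\<in>UNIV. pmf a \<omega> * mix x y (\<lambda>i j. F (\<omega>, i, j)))"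
proof -
  have "measure_pmf.expectation (pair_pmf a (pair_pmf x y)) F =
      (\<Sum>z\<in>UNIV. pmf (pair_pmf a (pair_pmf x y)) z * F z)"
    by (subst integral_measure_pmf[of UNIV]) simp_all
  also have "\<dots> = (\<Sum>\<omega>\<in>UNIV. pmf a \<omega> * mix x y (\<lambda>i j. F (\<omega>, i, j)))"
    by (simp add: pmf_pair mix_def sum_distrib_left sum.cartesian_product' mult.assoc flip: UNIV_Times_UNIV)
  finally show ?thesis .
qed

lemma Val_eq_mix: "Val a = (SUP x. INF y. mix x y a)"
  by (simp add: Val_def mix_def)

lemma norm_prob_simplex_le: "p \<in> prob_simplex \<Longrightarrow> norm p \<le> 1"
  using norm_le_l1_cart[of p] by (simp add: prob_simplex_def)

lemma vector_matrix_prob_simplex: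
  fixes A :: "real ^ 'w::finite ^ 'w"
  assumes "p \<in> prob_simplex" "row_stochastic A"
  shows "p v* A \<in> prob_simplex"
proof -
  have A: "0 \<le> A $ \<omega> $ \<omega>'" "(\<Sum>k\<in>UNIV. A $ \<omega> $ k) = 1" for \<omega> \<omega>'
    using assms(2) by (auto simp: row_stochastic_def prob_simplex_def row_def)
  have "(\<Sum>k\<in>UNIV. (p v* A) $ k) = (\<Sum>\<omega>\<in>UNIV. \<Sum>k\<in>UNIV. A $ \<omega> $ k * p $ \<omega>)"
    unfolding vector_matrix_mult_def vec_lambda_beta by (subst sum.swap) (simp add: mult.commute)
  also have "\<dots> = 1"
    using assms(1) unfolding sum_distrib_right[symmetric] A(2) by (simp add: prob_simplex_def)
  finally show ?thesis
    using assms(1) A(1) by (auto simp: prob_simplex_def vector_matrix_mult_def intro!: sum_nonneg)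
qed

lemma stochastic_mult_bound:
  fixes A :: "real ^ 'w::finite ^ 'w"
  assumes "row_stochastic A" "\<And>\<omega>. \<bar>x $ \<omega>\<bar> \<le> B"
  shows "\<bar>(A *v x) $ \<omega>\<bar> \<le> B"
proof -
  have A: "0 \<le> A $ \<omega> $ \<omega>'" "(\<Sum>k\<in>UNIV. A $ \<omega> $ k) = 1" for \<omega> \<omega>'
    using assms(1) by (auto simp: row_stochastic_def prob_simplex_def row_def)
  have "\<bar>(A *v x) $ \<omega>\<bar> \<le> (\<Sum>k\<in>UNIV. \<bar>A $ \<omega> $ k * x $ k\<bar>)"
    unfolding matrix_vector_mult_def by simp
  also have "\<dots> \<le> (\<Sum>k\<in>UNIV. A $ \<omega> $ k * B)"
    using A(1) assms(2) by (intro sum_mono) (simp add: abs_mult mult_left_mono)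
  also have "\<dots> = B"
    by (simp add: A(2) flip: sum_distrib_right)
  finally show ?thesis .
qed

section \<open>Tails of partitions and discount weights\<close>

definition tail_partition :: "(nat \<Rightarrow> real) \<Rightarrow> nat \<Rightarrow> nat \<Rightarrow> real" where
  "tail_partition t n k = t (n + k) - t n"

lemma stage_dur_tail_partition: "stage_dur (tail_partition t n) k = stage_dur t (n + k)"
  by (simp add: tail_partition_def stage_dur_def)

lemma tail_partition_Suc: "tail_partition t (Suc n) = tail_partition (tail_partition t n) 1"
  by (auto simp: tail_partition_def)

definition fine_partition :: "real \<Rightarrow> (nat \<Rightarrow> real) \<Rightarrow> bool" where
  "fine_partition d t \<longleftrightarrow> time_partition t \<and> (\<forall>n. stage_dur t n \<le> d)"

lemma stage_dur_pos: "time_partition t \<Longrightarrow> 0 < stage_dur t n"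
  by (simp add: time_partition_def stage_dur_def strict_mono_Suc_iff)

lemma fine_partition_mono: "fine_partition d t \<Longrightarrow> d \<le> d' \<Longrightarrow> fine_partition d' t"
  by (auto simp: fine_partition_def intro: order_trans)

lemma fine_partition_tail: "fine_partition d t \<Longrightarrow> fine_partition d (tail_partition t n)"
proof -
  assume t: "fine_partition d t"
  have "filterlim (\<lambda>k. t (n + k)) at_top sequentially"
    using t filterlim_compose[of t at_top sequentially "\<lambda>k. n + k" sequentially]
      filterlim_subseq[of "\<lambda>k. n + k"]
    by (simp add: fine_partition_def time_partition_def strict_mono_def)
  then have "filterlim (tail_partition t n) at_top sequentially"
    unfolding tail_partition_def using filterlim_tendsto_add_at_top[OF tendsto_const[of "- t n"]] by simp
  then show ?thesis
    using t by (auto simp: fine_partition_def time_partition_def stage_dur_tail_partition strict_mono_def tail_partition_def)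
qed

lemma fine_partition_uniform: "0 < d \<Longrightarrow> fine_partition d (\<lambda>n. d * real n)"
proof -
  assume "0 < d"
  moreover have "filterlim (\<lambda>n. d * real n) at_top sequentially"
    using \<open>0 < d\<close> by (intro filterlim_tendsto_pos_mult_at_top[OF tendsto_const] filterlim_real_sequentially)
  ultimately show ?thesis
    by (auto simp: fine_partition_def time_partition_def stage_dur_def strict_mono_def algebra_simps)
qed

definition weight :: "(nat \<Rightarrow> real) \<Rightarrow> real \<Rightarrow> nat \<Rightarrow> real" where
  "weight t lam n = stage_dur t n * lam * exp (- lam * t n)"

text \<open>A telescoping series dominates the weights:
  \<open>x \<le> exp x - 1 = exp x * (1 - exp (- x))\<close> with \<open>x = lam * h\<close>, and
  \<open>h \<le> 1\<close> bounds the prefactor by \<open>exp lam\<close>. The bound is the same for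
  all partitions, and so are the Lipschitz constants derived from it.\<close>

lemma weight_bounds:
  assumes "fine_partition 1 t" "lam > 0"
  shows "0 \<le> weight t lam n" "summable (weight t lam)" "(\<Sum>n. weight t lam n) \<le> exp lam"
proof -
  have t: "time_partition t" "stage_dur t n \<le> 1" for n
    using assms(1) by (auto simp: fine_partition_def)
  show nonneg: "0 \<le> weight t lam n" for n
    using stage_dur_pos[OF t(1), of n] assms(2) by (simp add: weight_def)
  let ?e = "\<lambda>n. exp (- lam * t n)"
  have le: "weight t lam n \<le> exp lam * (?e n - ?e (Suc n))" for n
  proof -
    let ?h = "stage_dur t n"
    have "?h * lam \<le> exp (?h * lam) - 1"
      using exp_ge_add_one_self[of "?h * lam"] by linarith
    also have "\<dots> = exp (?h * lam) * (1 - exp (- lam * ?h))"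
      by (simp add: algebra_simps flip: exp_add)
    also have "\<dots> \<le> exp lam * (1 - exp (- lam * ?h))"
      using t(2)[of n] stage_dur_pos[OF t(1), of n] assms(2) by (intro mult_right_mono) auto
    finally have "weight t lam n \<le> exp lam * (1 - exp (- lam * ?h)) * ?e n"
      unfolding weight_def by (intro mult_right_mono) auto
    also have "\<dots> = exp lam * (?e n - ?e (Suc n))"
      by (simp add: stage_dur_def algebra_simps flip: exp_add)
    finally show ?thesis .
  qed
  have "filterlim (\<lambda>n. lam * t n) at_top sequentially"
    using t(1) assms(2) by (intro filterlim_tendsto_pos_mult_at_top[OF tendsto_const]) (auto simp: time_partition_def)
  then have "?e \<longlonglongrightarrow> 0"
    by (auto intro!: filterlim_compose[OF exp_at_bot] simp: filterlim_uminus_at_bot)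
  from telescope_sums'[OF this] have "(\<lambda>n. ?e n - ?e (Suc n)) sums 1"
    using t(1) by (simp add: time_partition_def)
  then have s: "(\<lambda>n. exp lam * (?e n - ?e (Suc n))) sums exp lam"
    using sums_mult[of _ 1 "exp lam"] by simp
  show "summable (weight t lam)"
    using le nonneg by (intro summable_comparison_test'[OF sums_summable[OF s], of 0]) auto
  then show "(\<Sum>n. weight t lam n) \<le> exp lam"
    using suminf_le[OF le _ sums_summable[OF s]] s by (simp add: sums_iff)
qed

text \<open>Restarting the clock at 0 costs the discount over the first stage, which becomes the
  factor before the continuation value in the Bellman equation.\<close>

lemma weight_Suc:
  assumes "t 0 = 0"
  shows "weight t lam (Suc n) = exp (- lam * stage_dur t 0) * weight (tail_partition t 1) lam n"
  using assms by (simp add: weight_def stage_dur_tail_partition) (simp add: tail_partition_def stage_dur_def algebra_simps flip: exp_add)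

section \<open>Backward recursion for the expected payoff\<close>

locale state_blind_game =
  fixes g :: "'i::finite \<Rightarrow> 'j::finite \<Rightarrow> 'w::finite \<Rightarrow> real"
    and P q :: "'i \<Rightarrow> 'j \<Rightarrow> real ^ 'w ^ 'w"
    and lam :: real
  assumes stochastic: "row_stochastic (P i j)"
    and kernel: "q i j = P i j - mat 1"
    and lam_pos: "lam > 0"
begin

abbreviation transition :: "real \<Rightarrow> 'i \<Rightarrow> 'j \<Rightarrow> real ^ 'w ^ 'w" where
  "transition h i j \<equiv> mat 1 + h *\<^sub>R q i j"

lemma transition_stochastic: "0 \<le> h \<Longrightarrow> h \<le> 1 \<Longrightarrow> row_stochastic (transition h i j)"
  using row_stochastic_duration[OF stochastic] by (simp add: kernel)

lemma transition_stage_dur: "fine_partition 1 t \<Longrightarrow> row_stochastic (transition (stage_dur t n) i j)"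
  by (rule transition_stochastic) (auto simp: fine_partition_def less_imp_le[OF stage_dur_pos])

text \<open>The backward transition operator: coordinate \<omega> is the conditional expectation of
  \<open>\<phi>\<close> at the next history and state, given the history \<open>l\<close> and the
  current state \<omega>. The strategies see only \<open>l\<close>, so the same mixed actions serve
  every coordinate.\<close>

definition back_step ::
  "(nat \<Rightarrow> real) \<Rightarrow> ('i, 'j) strategy1 \<Rightarrow> ('i, 'j) strategy2 \<Rightarrow>
     (('i \<times> 'j) list \<Rightarrow> real ^ 'w) \<Rightarrow> ('i \<times> 'j) list \<Rightarrow> real ^ 'w" where
  "back_step t \<sigma> \<tau> \<phi> l =
     mix (\<sigma> l) (\<tau> l) (\<lambda>i j. transition (stage_dur t (length l)) i j *v \<phi> (l @ [(i, j)]))"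

definition stage_gain :: "('i, 'j) strategy1 \<Rightarrow> ('i, 'j) strategy2 \<Rightarrow> ('i \<times> 'j) list \<Rightarrow> real ^ 'w" where
  "stage_gain \<sigma> \<tau> l = mix (\<sigma> l) (\<tau> l) (\<lambda>i j. \<chi> \<omega>. g i j \<omega>)"

text \<open>Coordinate \<omega> is the expected payoff \<open>n\<close> stages after the history
  \<open>l\<close> if the state at \<open>l\<close> is \<omega>. The initial belief does not
  enter.\<close>

definition future_gain ::
  "(nat \<Rightarrow> real) \<Rightarrow> ('i, 'j) strategy1 \<Rightarrow> ('i, 'j) strategy2 \<Rightarrow> nat \<Rightarrow> ('i \<times> 'j) list \<Rightarrow> real ^ 'w" where
  "future_gain t \<sigma> \<tau> n = (back_step t \<sigma> \<tau> ^^ n) (stage_gain \<sigma> \<tau>)"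

lemma future_gain_Suc: "future_gain t \<sigma> \<tau> (Suc n) = back_step t \<sigma> \<tau> (future_gain t \<sigma> \<tau> n)"
  by (simp add: future_gain_def)

text \<open>Back steps append to the end of the history, so a fixed first pair stays in front and
  can be absorbed into the strategies and the partition.\<close>

lemma future_gain_Cons:
  "future_gain t \<sigma> \<tau> n (a # l) = future_gain (tail_partition t 1) (\<lambda>l. \<sigma> (a # l)) (\<lambda>l. \<tau> (a # l)) n l"
proof (induction n arbitrary: l)
  case 0
  then show ?case by (simp add: future_gain_def stage_gain_def)
next
  case (Suc n)
  then show ?case
    by (simp add: future_gain_Suc back_step_def stage_dur_tail_partition)
qed

definition gain_bound :: real where
  "gain_bound = (\<Sum>i\<in>UNIV. \<Sum>j\<in>UNIV. \<Sum>\<omega>\<in>UNIV. \<bar>g i j \<omega>\<bar>)"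

lemma gain_le: "\<bar>g i j \<omega>\<bar> \<le> gain_bound"
proof -
  have "\<bar>g i j \<omega>\<bar> \<le> (\<Sum>\<omega>\<in>UNIV. \<bar>g i j \<omega>\<bar>)"
    by (rule member_le_sum) auto
  also have "\<dots> \<le> (\<Sum>j\<in>UNIV. \<Sum>\<omega>\<in>UNIV. \<bar>g i j \<omega>\<bar>)"
    by (rule member_le_sum[of j UNIV "\<lambda>j. \<Sum>\<omega>\<in>UNIV. \<bar>g i j \<omega>\<bar>"]) (auto intro: sum_nonneg)
  also have "\<dots> \<le> gain_bound"
    unfolding gain_bound_def
    by (rule member_le_sum[of i UNIV "\<lambda>i. \<Sum>j\<in>UNIV. \<Sum>\<omega>\<in>UNIV. \<bar>g i j \<omega>\<bar>"]) (auto intro: sum_nonneg)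
  finally show ?thesis .
qed

lemma mix_nth: "mix x y a $ \<omega> = mix x y (\<lambda>i j. a i j $ \<omega>)" for a :: "'i \<Rightarrow> 'j \<Rightarrow> real ^ 'w"
  by (rule mix_linear) (simp add: linear_iff)

lemma future_gain_le:
  assumes "fine_partition 1 t"
  shows "\<bar>future_gain t \<sigma> \<tau> n l $ \<omega>\<bar> \<le> gain_bound"
proof (induction n arbitrary: l \<omega>)
  case 0
  show ?case
    by (auto simp: future_gain_def stage_gain_def mix_nth intro!: mix_abs_le gain_le)
next
  case (Suc n)
  show ?case
    unfolding future_gain_Suc back_step_def mix_nth
    by (intro mix_abs_le stochastic_mult_bound transition_stage_dur assms Suc)
qed

lemma norm_future_gain_le:
  assumes "fine_partition 1 t"
  shows "norm (future_gain t \<sigma> \<tau> n l) \<le> CARD('w) * gain_bound"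
proof -
  have "norm (future_gain t \<sigma> \<tau> n l) \<le> (\<Sum>\<omega>\<in>UNIV. \<bar>future_gain t \<sigma> \<tau> n l $ \<omega>\<bar>)"
    by (rule norm_le_l1_cart)
  also have "\<dots> \<le> (\<Sum>\<omega>\<in>(UNIV::'w set). gain_bound)"
    by (intro sum_mono future_gain_le assms)
  finally show ?thesis by simp
qed

text \<open>Resampling stage \<open>n\<close> leaves the earlier action pairs alone, so only the
  average over the stage law remains. Read backwards with \<open>f\<close> constant in the actions,
  the lemma replaces an average over the state law by the state itself.\<close>

lemma integral_stage:
  fixes f :: "'w \<times> 'i \<times> 'j \<Rightarrow> ('i \<times> 'j) list \<Rightarrow> real"
  shows "(\<integral>\<xi>. f (\<xi> n) (action_hist \<xi> n) \<partial>play_measure t q p \<sigma> \<tau>) =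
    (\<integral>\<xi>. (\<Sum>\<omega>\<in>UNIV. pmf (state_law t q p n \<xi>) \<omega> *
       mix (\<sigma> (action_hist \<xi> n)) (\<tau> (action_hist \<xi> n)) (\<lambda>i j. f (\<omega>, i, j) (action_hist \<xi> n)))
      \<partial>play_measure t q p \<sigma> \<tau>)"
proof (subst integral_play_measure_step[where n = n])
  have hist: "action_hist (\<xi>(n := x)) n = action_hist \<xi> n" for \<xi> :: "nat \<Rightarrow> 'w \<times> 'i \<times> 'j" and x
    by (simp add: action_hist_def)
  show "f (\<xi> n) (action_hist \<xi> n) = f (\<xi>' n) (action_hist \<xi>' n)"
    if "\<And>k. k \<le> n \<Longrightarrow> \<xi> k = \<xi>' k" for \<xi> \<xi>' :: "nat \<Rightarrow> 'w \<times> 'i \<times> 'j"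
  proof -
    from that have "action_hist \<xi> n = action_hist \<xi>' n" by (simp add: action_hist_def)
    with that show ?thesis by simp
  qed
  show "(\<integral>\<xi>. (\<integral>x. f ((\<xi>(n := x)) n) (action_hist (\<xi>(n := x)) n)
      \<partial>measure_pmf (stage_law t q p \<sigma> \<tau> n \<xi>)) \<partial>play_measure t q p \<sigma> \<tau>) =
    (\<integral>\<xi>. (\<Sum>\<omega>\<in>UNIV. pmf (state_law t q p n \<xi>) \<omega> *
       mix (\<sigma> (action_hist \<xi> n)) (\<tau> (action_hist \<xi> n)) (\<lambda>i j. f (\<omega>, i, j) (action_hist \<xi> n)))
      \<partial>play_measure t q p \<sigma> \<tau>)"
    by (simp add: hist stage_law_def expectation_pair_pmf_mix)
qed

text \<open>Duality between pushing the law of history and state forward and pulling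
  \<open>\<phi>\<close> back. The induction needs arbitrary \<open>\<phi>\<close>: one stage trades
  \<open>\<phi>\<close> at \<open>Suc n\<close> for its back step at \<open>n\<close>, so the joint
  law is never computed.\<close>

lemma integral_hist:
  assumes t: "fine_partition 1 t" and p: "p \<in> prob_simplex"
  shows "(\<integral>\<xi>. \<phi> (action_hist \<xi> n) $ fst (\<xi> n) \<partial>play_measure t q p \<sigma> \<tau>) =
    p \<bullet> (back_step t \<sigma> \<tau> ^^ n) \<phi> []"
proof (induction n arbitrary: \<phi>)
  case 0
  interpret prob_space "play_measure t q p \<sigma> \<tau>" by (rule prob_space_play_measure)
  show ?case
    by (subst integral_stage)
      (simp add: mix_const action_hist_def state_law_def pmf_vec_pmf[OF p] prob_space inner_vec_def)
next
  case (Suc n)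
  let ?L = "play_measure t q p \<sigma> \<tau>"
  have hist: "action_hist \<xi> (Suc n) = action_hist \<xi> n @ [snd (\<xi> n)]" for \<xi> :: "nat \<Rightarrow> 'w \<times> 'i \<times> 'j"
    by (simp add: action_hist_def)
  define f where "f x l = (transition (stage_dur t n) (fst (snd x)) (snd (snd x)) *v \<phi> (l @ [snd x])) $ fst x"
    for x :: "'w \<times> 'i \<times> 'j" and l
  have "(\<integral>\<xi>. \<phi> (action_hist \<xi> (Suc n)) $ fst (\<xi> (Suc n)) \<partial>?L) =
    (\<integral>\<xi>. (\<Sum>\<omega>\<in>UNIV. pmf (state_law t q p (Suc n) \<xi>) \<omega> * \<phi> (action_hist \<xi> (Suc n)) $ \<omega>) \<partial>?L)"
    by (subst integral_stage) (simp add: mix_const)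
  also have "\<dots> = (\<integral>\<xi>. f (\<xi> n) (action_hist \<xi> n) \<partial>?L)"
  proof (rule Bochner_Integration.integral_cong[OF refl])
    fix \<xi> :: "nat \<Rightarrow> 'w \<times> 'i \<times> 'j"
    obtain \<omega> i j where \<xi>: "\<xi> n = (\<omega>, i, j)" by (cases "\<xi> n") auto
    \<comment> \<open>The law of the next state is a row of the transition matrix; averaging
      \<open>\<phi>\<close> against it is one coordinate of a matrix-vector product.\<close>
    have "row \<omega> (transition (stage_dur t n) i j) \<in> prob_simplex"
      using transition_stage_dur[OF t] by (simp add: row_stochastic_def)
    then show "(\<Sum>\<omega>\<in>UNIV. pmf (state_law t q p (Suc n) \<xi>) \<omega> * \<phi> (action_hist \<xi> (Suc n)) $ \<omega>) =
        f (\<xi> n) (action_hist \<xi> n)"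
      by (simp add: state_law_def \<xi> pmf_vec_pmf f_def hist matrix_vector_mult_def) (simp add: row_def)
  qed
  also have "\<dots> = (\<integral>\<xi>. (\<Sum>\<omega>\<in>UNIV. pmf (state_law t q p n \<xi>) \<omega> *
      back_step t \<sigma> \<tau> \<phi> (action_hist \<xi> n) $ \<omega>) \<partial>?L)"
    by (subst integral_stage) (simp add: back_step_def f_def mix_nth action_hist_def)
  also have "\<dots> = (\<integral>\<xi>. back_step t \<sigma> \<tau> \<phi> (action_hist \<xi> n) $ fst (\<xi> n) \<partial>?L)"
    by (subst integral_stage[where f = "\<lambda>x l. back_step t \<sigma> \<tau> \<phi> l $ fst x"]) (simp add: mix_const)
  also have "\<dots> = p \<bullet> (back_step t \<sigma> \<tau> ^^ Suc n) \<phi> []"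
    by (simp add: Suc funpow_swap1)
  finally show ?case .
qed

lemma integral_gain:
  assumes t: "fine_partition 1 t" and p: "p \<in> prob_simplex"
  shows "(\<integral>\<xi>. (case \<xi> n of (\<omega>, i, j) \<Rightarrow> g i j \<omega>) \<partial>play_measure t q p \<sigma> \<tau>) =
    p \<bullet> future_gain t \<sigma> \<tau> n []"
proof -
  let ?L = "play_measure t q p \<sigma> \<tau>"
  have "(\<integral>\<xi>. (case \<xi> n of (\<omega>, i, j) \<Rightarrow> g i j \<omega>) \<partial>?L) =
    (\<integral>\<xi>. (\<Sum>\<omega>\<in>UNIV. pmf (state_law t q p n \<xi>) \<omega> *
      stage_gain \<sigma> \<tau> (action_hist \<xi> n) $ \<omega>) \<partial>?L)"
    using integral_stage[where f = "\<lambda>x l. case x of (\<omega>, i, j) \<Rightarrow> g i j \<omega>"]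
    by (simp add: stage_gain_def mix_nth)
  also have "\<dots> = (\<integral>\<xi>. stage_gain \<sigma> \<tau> (action_hist \<xi> n) $ fst (\<xi> n) \<partial>?L)"
    by (subst integral_stage[where f = "\<lambda>x l. stage_gain \<sigma> \<tau> l $ fst x"]) (simp add: mix_const)
  also have "\<dots> = p \<bullet> future_gain t \<sigma> \<tau> n []"
    unfolding future_gain_def by (rule integral_hist[OF assms])
  finally show ?thesis .
qed

text \<open>The weights dominate, so sum and integral exchange. The belief appears only in the inner
  product, which exhibits the payoff of fixed strategies as linear in \<open>p\<close>.\<close>

lemma expected_payoff_sums:
  assumes t: "fine_partition 1 t" and p: "p \<in> prob_simplex"
  shows "(\<lambda>n. weight t lam n * (p \<bullet> future_gain t \<sigma> \<tau> n [])) sums expected_payoff t lam g q p \<sigma> \<tau>"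
proof -
  let ?L = "play_measure t q p \<sigma> \<tau>"
  interpret prob_space ?L by (rule prob_space_play_measure)
  let ?g = "\<lambda>n \<xi>. weight t lam n * (case \<xi> n of (\<omega>, i, j) \<Rightarrow> g i j \<omega>)"
  note w = weight_bounds[OF t lam_pos]
  have le: "norm (?g n \<xi>) \<le> weight t lam n * gain_bound" for n and \<xi> :: "nat \<Rightarrow> 'w \<times> 'i \<times> 'j"
    using gain_le w(1) by (auto simp: abs_mult split: prod.split intro!: mult_left_mono)
  have sw: "summable (\<lambda>n. weight t lam n * gain_bound)"
    by (intro summable_mult2 w)
  have meas: "?g n \<in> borel_measurable ?L" for n
  proof -
    have [measurable]: "(\<lambda>\<xi>. \<xi> n) \<in> ?L \<rightarrow>\<^sub>M count_space (UNIV :: ('w \<times> 'i \<times> 'j) set)"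
      unfolding measurable_cong_sets[OF prob_space_play_measure(2) refl]
      by (rule measurable_component_singleton) simp
    show ?thesis by measurable
  qed
  have int: "integrable ?L (?g n)" for n
    by (rule integrable_const_bound[of _ "weight t lam n * gain_bound"]) (use le meas in auto)
  have "(\<lambda>n. \<integral>\<xi>. ?g n \<xi> \<partial>?L) sums (\<integral>\<xi>. (\<Sum>n. ?g n \<xi>) \<partial>?L)"
  proof (rule sums_integral[OF int])
    show "AE \<xi> in ?L. summable (\<lambda>n. norm (?g n \<xi>))"
      using le by (intro AE_I2 summable_comparison_test'[OF sw, of 0]) auto
    show "summable (\<lambda>n. \<integral>\<xi>. norm (?g n \<xi>) \<partial>?L)"
    proof (rule summable_comparison_test'[OF sw, of 0])
      fix n
      have "(\<integral>\<xi>. norm (?g n \<xi>) \<partial>?L) \<le> (\<integral>\<xi>. weight t lam n * gain_bound \<partial>?L)"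
        by (intro integral_mono int integrable_norm le) simp
      then show "norm (\<integral>\<xi>. norm (?g n \<xi>) \<partial>?L) \<le> weight t lam n * gain_bound"
        by (simp add: prob_space abs_of_nonneg)
    qed
  qed
  moreover have "(\<lambda>n. \<integral>\<xi>. ?g n \<xi> \<partial>?L) = (\<lambda>n. weight t lam n * (p \<bullet> future_gain t \<sigma> \<tau> n []))"
    using integral_gain[OF assms] by simp
  ultimately show ?thesis
    by (simp only: expected_payoff_def discounted_payoff_def weight_def)
qed

definition payoff_bound :: real where
  "payoff_bound = exp lam * (CARD('w) * gain_bound)"

text \<open>Here \<open>d\<close> is any vector, so that one estimate serves both a belief
  (boundedness) and a difference of two beliefs (Lipschitz continuity).\<close>

lemma expected_payoff_bound_aux:
  assumes t: "fine_partition 1 t"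
    and s: "(\<lambda>n. weight t lam n * (d \<bullet> future_gain t \<sigma> \<tau> n [])) sums s"
  shows "\<bar>s\<bar> \<le> payoff_bound * norm d"
proof -
  note w = weight_bounds[OF t lam_pos]
  let ?C = "CARD('w) * gain_bound"
  have le: "\<bar>weight t lam n * (d \<bullet> future_gain t \<sigma> \<tau> n [])\<bar> \<le> weight t lam n * (?C * norm d)" for n
  proof -
    have "\<bar>d \<bullet> future_gain t \<sigma> \<tau> n []\<bar> \<le> norm d * norm (future_gain t \<sigma> \<tau> n [])"
      by (rule Cauchy_Schwarz_ineq2)
    also have "\<dots> \<le> norm d * ?C"
      by (intro mult_left_mono norm_future_gain_le t) auto
    finally show ?thesis
      using w(1)[of n] by (simp add: abs_mult mult_left_mono mult.commute)
  qed
  have "\<bar>s\<bar> \<le> (\<Sum>n. weight t lam n * (?C * norm d))"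
    using s norm_suminf_le[OF _ summable_mult2[OF w(2)], of "\<lambda>n. weight t lam n * (d \<bullet> future_gain t \<sigma> \<tau> n [])" "?C * norm d"] le
    by (simp add: sums_iff)
  also have "\<dots> = (\<Sum>n. weight t lam n) * (?C * norm d)"
    by (rule suminf_mult2[OF w(2), symmetric])
  also have "\<dots> \<le> exp lam * (?C * norm d)"
    using w(3) gain_le by (intro mult_right_mono) (auto simp: gain_bound_def intro!: mult_nonneg_nonneg sum_nonneg)
  finally show ?thesis by (simp add: payoff_bound_def mult.assoc)
qed

lemma payoff_bound_nonneg: "0 \<le> payoff_bound"
  by (auto simp: payoff_bound_def gain_bound_def intro!: mult_nonneg_nonneg sum_nonneg)

lemma expected_payoff_le:
  assumes t: "fine_partition 1 t" and p: "p \<in> prob_simplex"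
  shows "\<bar>expected_payoff t lam g q p \<sigma> \<tau>\<bar> \<le> payoff_bound"
proof -
  have "\<bar>expected_payoff t lam g q p \<sigma> \<tau>\<bar> \<le> payoff_bound * norm p"
    by (rule expected_payoff_bound_aux[OF t expected_payoff_sums[OF assms]])
  also have "\<dots> \<le> payoff_bound * 1"
    by (intro mult_left_mono norm_prob_simplex_le p payoff_bound_nonneg)
  finally show ?thesis by simp
qed

lemma expected_payoff_lipschitz:
  assumes t: "fine_partition 1 t" and p: "p \<in> prob_simplex" "p' \<in> prob_simplex"
  shows "\<bar>expected_payoff t lam g q p \<sigma> \<tau> - expected_payoff t lam g q p' \<sigma> \<tau>\<bar> \<le> payoff_bound * norm (p - p')"
  using sums_diff[OF expected_payoff_sums[OF t p(1)] expected_payoff_sums[OF t p(2)]]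
  by (intro expected_payoff_bound_aux[OF t]) (simp add: inner_diff_left right_diff_distrib)

text \<open>Actions are drawn independently of the state, so after observing them the belief is just
  the image of \<open>p\<close> under the transition matrix. In the series, the matrix moves from
  the future gain to the belief by transposition.\<close>

lemma expected_payoff_rec:
  fixes \<sigma> :: "('i, 'j) strategy1" and \<tau> :: "('i, 'j) strategy2"
  assumes t: "fine_partition 1 t" and p: "p \<in> prob_simplex"
  defines "h \<equiv> stage_dur t 0"
  shows "expected_payoff t lam g q p \<sigma> \<tau> = mix (\<sigma> []) (\<tau> []) (\<lambda>i j. h * lam * mean_payoff g i j p +
    exp (- lam * h) * expected_payoff (tail_partition t 1) lam g q (p v* transition h i j)
      (\<lambda>l. \<sigma> ((i, j) # l)) (\<lambda>l. \<tau> ((i, j) # l)))"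
proof -
  have t0: "t 0 = 0" using t by (simp add: fine_partition_def time_partition_def)
  let ?E = "\<lambda>i j. expected_payoff (tail_partition t 1) lam g q (p v* transition h i j)
      (\<lambda>l. \<sigma> ((i, j) # l)) (\<lambda>l. \<tau> ((i, j) # l))"
  let ?F = "\<lambda>i j n. future_gain (tail_partition t 1) (\<lambda>l. \<sigma> ((i, j) # l)) (\<lambda>l. \<tau> ((i, j) # l)) n []"
  have lin: "linear (\<lambda>x. p \<bullet> x)" by (simp add: bounded_linear.linear bounded_linear_inner_right)
  have Suc: "weight t lam (Suc n) * (p \<bullet> future_gain t \<sigma> \<tau> (Suc n) []) =
     mix (\<sigma> []) (\<tau> []) (\<lambda>i j. exp (- lam * h) * (weight (tail_partition t 1) lam n * ((p v* transition h i j) \<bullet> ?F i j n)))" for n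
    by (simp add: weight_Suc[of t lam n, OF t0] future_gain_Suc back_step_def future_gain_Cons mix_linear[OF lin]
        h_def dot_lmul_matrix mix_mult mult.assoc)
  have "(\<lambda>n. weight t lam (Suc n) * (p \<bullet> future_gain t \<sigma> \<tau> (Suc n) [])) sums
     mix (\<sigma> []) (\<tau> []) (\<lambda>i j. exp (- lam * h) * ?E i j)"
    unfolding Suc h_def
    by (intro mix_sums sums_mult expected_payoff_sums fine_partition_tail t vector_matrix_prob_simplex p transition_stage_dur)
  from sums_unique2[OF sums_Suc[OF this] expected_payoff_sums[OF t p]]
  have E: "expected_payoff t lam g q p \<sigma> \<tau> =
    mix (\<sigma> []) (\<tau> []) (\<lambda>i j. exp (- lam * h) * ?E i j) + weight t lam 0 * (p \<bullet> future_gain t \<sigma> \<tau> 0 [])"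
    by simp
  have "p \<bullet> (\<chi> \<omega>. g i j \<omega>) = mean_payoff g i j p" for i j
    by (simp add: mean_payoff_def inner_vec_def)
  then have "weight t lam 0 * (p \<bullet> future_gain t \<sigma> \<tau> 0 []) =
      mix (\<sigma> []) (\<tau> []) (\<lambda>i j. h * lam * mean_payoff g i j p)"
    by (simp add: weight_def t0 future_gain_def stage_gain_def mix_linear[OF lin] h_def mix_mult)
  with E show ?thesis by (simp add: mix_add)
qed

end

section \<open>The Bellman equation\<close>

text \<open>Nearly optimal choices stand in for the conditionally complete \<open>SUP\<close> and
  \<open>INF\<close>, which behave well only for bounded \<open>K\<close>. The rules serve mixed
  actions (\<open>Val\<close>) and strategies (\<open>game_value\<close>) alike. In the upper rules
  \<open>y\<close> is a reply to a given \<open>x\<close>.\<close>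

lemma
  fixes K :: "'x \<Rightarrow> 'y \<Rightarrow> real"
  assumes K: "\<And>x y. \<bar>K x y\<bar> \<le> B"
  shows SUP_INF_lower: "e > 0 \<Longrightarrow> \<exists>x. \<forall>y. (SUP x. INF y. K x y) - e \<le> K x y"
    and SUP_INF_upper: "e > 0 \<Longrightarrow> \<exists>y. K x y \<le> (SUP x. INF y. K x y) + e"
    and SUP_INF_geI: "(\<And>e. e > 0 \<Longrightarrow> \<exists>x. \<forall>y. c - e \<le> K x y) \<Longrightarrow> c \<le> (SUP x. INF y. K x y)"
    and SUP_INF_leI: "(\<And>e x. e > 0 \<Longrightarrow> \<exists>y. K x y \<le> c + e) \<Longrightarrow> (SUP x. INF y. K x y) \<le> c"
proof -
  have below: "bdd_below (range (K x))" for x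
    using K by (intro bdd_belowI[of _ "- B"]) (auto simp: abs_le_iff minus_le_iff)
  have "(INF y. K x y) \<le> B" for x
    using cINF_lower[OF below, of undefined x] K[of x undefined] by simp
  then have above: "bdd_above (range (\<lambda>x. INF y. K x y))"
    by (intro bdd_aboveI[of _ B]) auto
  {
    fix e :: real assume "e > 0"
    then obtain x where "(SUP x. INF y. K x y) - e < (INF y. K x y)"
      using less_cSUP_iff[OF _ above, of "(SUP x. INF y. K x y) - e"] by auto
    moreover have "(INF y. K x y) \<le> K x y" for y
      by (rule cINF_lower[OF below]) simp
    ultimately show "\<exists>x. \<forall>y. (SUP x. INF y. K x y) - e \<le> K x y"
      by (meson less_le_trans less_imp_le)
  }
  {
    fix e :: real and x assume "e > 0"
    then have "(INF y. K x y) < (INF y. K x y) + e" by simp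
    then obtain y where "K x y < (INF y. K x y) + e"
      using cINF_less_iff[OF _ below, of x "(INF y. K x y) + e"] by auto
    moreover have "(INF y. K x y) \<le> (SUP x. INF y. K x y)"
      by (rule cSUP_upper[OF _ above]) simp
    ultimately show "\<exists>y. K x y \<le> (SUP x. INF y. K x y) + e"
      by (intro exI[of _ y]) simp
  }
  {
    assume *: "\<And>e. e > 0 \<Longrightarrow> \<exists>x. \<forall>y. c - e \<le> K x y"
    show "c \<le> (SUP x. INF y. K x y)"
    proof (rule field_le_epsilon)
      fix e :: real assume "e > 0"
      then obtain x where "\<And>y. c - e \<le> K x y" using * by blast
      then have "c - e \<le> (INF y. K x y)" by (intro cINF_greatest) auto
      also have "\<dots> \<le> (SUP x. INF y. K x y)"
        by (rule cSUP_upper[OF _ above]) simp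
      finally show "c \<le> (SUP x. INF y. K x y) + e" by simp
    qed
  }
  {
    assume *: "\<And>e x. e > 0 \<Longrightarrow> \<exists>y. K x y \<le> c + e"
    show "(SUP x. INF y. K x y) \<le> c"
    proof (rule cSUP_least)
      fix x
      show "(INF y. K x y) \<le> c"
      proof (rule field_le_epsilon)
        fix e :: real assume "e > 0"
        then obtain y where "K x y \<le> c + e" using * by blast
        moreover have "(INF y. K x y) \<le> K x y"
          by (rule cINF_lower[OF below]) simp
        ultimately show "(INF y. K x y) \<le> c + e" by simp
      qed
    qed simp
  }
qed

text \<open>The properties of \<open>Val\<close> on which the limit argument rests, chosen to be
  stable under an exchange of the players (see \<open>value_family_dual\<close>).\<close>

locale value_operator =
  fixes V :: "('i::finite \<Rightarrow> 'j::finite \<Rightarrow> real) \<Rightarrow> real"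
  assumes mono: "(\<And>i j. a i j \<le> b i j) \<Longrightarrow> V a \<le> V b"
    and add_const: "V (\<lambda>i j. a i j + c) = V a + c"
    and scale: "c > 0 \<Longrightarrow> V (\<lambda>i j. c * a i j) = c * V a"
begin

lemma le_add: "(\<And>i j. a i j \<le> b i j + c) \<Longrightarrow> V a \<le> V b + c"
  using mono[of a "\<lambda>i j. b i j + c"] by (simp add: add_const)

end

lemma mix_bounded: "\<bar>mix x y a\<bar> \<le> (\<Sum>i\<in>UNIV. \<Sum>j\<in>UNIV. \<bar>a i j\<bar>)" for a :: "'i::finite \<Rightarrow> 'j::finite \<Rightarrow> real"
proof (rule mix_abs_le)
  fix i j
  have "\<bar>a i j\<bar> \<le> (\<Sum>j\<in>UNIV. \<bar>a i j\<bar>)"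
    by (rule member_le_sum) auto
  also have "\<dots> \<le> (\<Sum>i\<in>UNIV. \<Sum>j\<in>UNIV. \<bar>a i j\<bar>)"
    by (rule member_le_sum[of i UNIV "\<lambda>i. \<Sum>j\<in>UNIV. \<bar>a i j\<bar>"]) (auto intro: sum_nonneg)
  finally show "\<bar>a i j\<bar> \<le> (\<Sum>i\<in>UNIV. \<Sum>j\<in>UNIV. \<bar>a i j\<bar>)" .
qed

lemmas Val_lower = SUP_INF_lower[where K = "\<lambda>x y. mix x y a", OF mix_bounded, folded Val_eq_mix]
  for a :: "'i::finite \<Rightarrow> 'j::finite \<Rightarrow> real"
lemmas Val_upper = SUP_INF_upper[where K = "\<lambda>x y. mix x y a", OF mix_bounded, folded Val_eq_mix]
  for a :: "'i::finite \<Rightarrow> 'j::finite \<Rightarrow> real"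
lemmas Val_geI = SUP_INF_geI[where K = "\<lambda>x y. mix x y a", OF mix_bounded, folded Val_eq_mix]
  for a :: "'i::finite \<Rightarrow> 'j::finite \<Rightarrow> real"
lemmas Val_leI = SUP_INF_leI[where K = "\<lambda>x y. mix x y a", OF mix_bounded, folded Val_eq_mix]
  for a :: "'i::finite \<Rightarrow> 'j::finite \<Rightarrow> real"

lemma value_operator_Val: "value_operator (Val :: ('i::finite \<Rightarrow> 'j::finite \<Rightarrow> real) \<Rightarrow> real)"
proof
  fix a b :: "'i \<Rightarrow> 'j \<Rightarrow> real" and c :: real
  show "Val a \<le> Val b" if "\<And>i j. a i j \<le> b i j"
  proof (rule Val_geI)
    fix e :: real assume "e > 0"
    then obtain x where "\<And>y. Val a - e \<le> mix x y a" using Val_lower by blast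
    then show "\<exists>x. \<forall>y. Val a - e \<le> mix x y b"
      using mix_mono[of a b, OF that] order_trans by blast
  qed
  show "Val (\<lambda>i j. a i j + c) = Val a + c"
  proof (rule antisym)
    show "Val (\<lambda>i j. a i j + c) \<le> Val a + c"
      using Val_upper[where a = a] by (intro Val_leI) (simp add: mix_add mix_const algebra_simps)
    show "Val a + c \<le> Val (\<lambda>i j. a i j + c)"
      using Val_lower[where a = a] by (intro Val_geI) (simp add: mix_add mix_const algebra_simps)
  qed
  show "Val (\<lambda>i j. c * a i j) = c * Val a" if c: "c > 0"
  proof (rule antisym)
    show "Val (\<lambda>i j. c * a i j) \<le> c * Val a"
    proof (rule Val_leI)
      fix e :: real and x :: "'i pmf" assume "e > 0"
      then obtain y where "mix x y a \<le> Val a + e / c" using Val_upper[where a = a and e = "e / c"] c by auto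
      then show "\<exists>y. mix x y (\<lambda>i j. c * a i j) \<le> c * Val a + e"
        using c by (intro exI[of _ y]) (simp add: mix_mult field_simps)
    qed
    show "c * Val a \<le> Val (\<lambda>i j. c * a i j)"
    proof (rule Val_geI)
      fix e :: real assume "e > 0"
      then obtain x where "\<And>y. Val a - e / c \<le> mix x y a" using Val_lower[where a = a and e = "e / c"] c by auto
      then show "\<exists>x. \<forall>y. c * Val a - e \<le> mix x y (\<lambda>i j. c * a i j)"
        using c by (intro exI[of _ x]) (simp add: mix_mult field_simps)
    qed
  qed
qed

locale value_equation = state_blind_game g P q lam + value_operator V
  for g :: "'i::finite \<Rightarrow> 'j::finite \<Rightarrow> 'w::finite \<Rightarrow> real"
    and P q :: "'i \<Rightarrow> 'j \<Rightarrow> real ^ 'w ^ 'w"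
    and lam :: real
    and V :: "('i \<Rightarrow> 'j \<Rightarrow> real) \<Rightarrow> real"

text \<open>An abstract copy of the game values. Its assumptions survive the passage from
  \<open>W\<close> to \<open>- W\<close>, so whatever is shown for upper limits transfers to lower
  limits.\<close>

locale value_family = value_equation g P q lam V
  for g :: "'i::finite \<Rightarrow> 'j::finite \<Rightarrow> 'w::finite \<Rightarrow> real"
    and P q :: "'i \<Rightarrow> 'j \<Rightarrow> real ^ 'w ^ 'w"
    and lam :: real
    and V :: "('i \<Rightarrow> 'j \<Rightarrow> real) \<Rightarrow> real" +
  fixes W :: "(nat \<Rightarrow> real) \<Rightarrow> real ^ 'w \<Rightarrow> real" and B :: real
  assumes bellman: "fine_partition 1 t \<Longrightarrow> p \<in> prob_simplex \<Longrightarrow>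
      W t p = V (\<lambda>i j. stage_dur t 0 * lam * mean_payoff g i j p +
        exp (- lam * stage_dur t 0) * W (tail_partition t 1) (p v* transition (stage_dur t 0) i j))"
    and bounded: "fine_partition 1 t \<Longrightarrow> p \<in> prob_simplex \<Longrightarrow> \<bar>W t p\<bar> \<le> B"
    and lipschitz: "fine_partition 1 t \<Longrightarrow> p \<in> prob_simplex \<Longrightarrow> p' \<in> prob_simplex \<Longrightarrow>
      W t p - W t p' \<le> B * norm (p - p')"

context state_blind_game
begin

lemma
  assumes t: "fine_partition 1 t" and p: "p \<in> prob_simplex"
  shows game_value_lower:
      "e > 0 \<Longrightarrow> \<exists>\<sigma>. \<forall>\<tau>. game_value t lam g q p - e \<le> expected_payoff t lam g q p \<sigma> \<tau>"
    and game_value_upper: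
      "e > 0 \<Longrightarrow> \<exists>\<tau>. expected_payoff t lam g q p \<sigma> \<tau> \<le> game_value t lam g q p + e"
    and game_value_geI:
      "(\<And>e. e > 0 \<Longrightarrow> \<exists>\<sigma>. \<forall>\<tau>. c - e \<le> expected_payoff t lam g q p \<sigma> \<tau>) \<Longrightarrow> c \<le> game_value t lam g q p"
    and game_value_leI:
      "(\<And>e \<sigma>. e > 0 \<Longrightarrow> \<exists>\<tau>. expected_payoff t lam g q p \<sigma> \<tau> \<le> c + e) \<Longrightarrow> game_value t lam g q p \<le> c"
  unfolding game_value_def
  by (rule SUP_INF_lower SUP_INF_upper SUP_INF_geI SUP_INF_leI,
      rule expected_payoff_le[OF t p], blast)+

text \<open>Dynamic programming: a nearly optimal first mixed action is glued to nearly optimal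
  continuations, one for each possible first action pair, with error \<open>e / 2\<close> for each
  of the two choices.\<close>

lemma value_family_game_value:
  "value_family g P q lam Val (\<lambda>t. game_value t lam g q) payoff_bound"
proof -
  interpret value_operator Val by (rule value_operator_Val)
  show ?thesis
  proof
    fix t and p :: "real ^ 'w" assume t: "fine_partition 1 t" and p: "p \<in> prob_simplex"
    let ?h = "stage_dur t 0"
    let ?p = "\<lambda>i j. p v* transition ?h i j"
    note t' = fine_partition_tail[OF t, of 1]
    have p': "?p i j \<in> prob_simplex" for i j
      by (intro vector_matrix_prob_simplex p transition_stage_dur t)
    let ?R = "\<lambda>i j. ?h * lam * mean_payoff g i j p + exp (- lam * ?h) * game_value (tail_partition t 1) lam g q (?p i j)"
    \<comment> \<open>Discounting does not enlarge the error of the continuation strategies.\<close>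
    have "0 < ?h" using t by (auto simp: fine_partition_def intro: stage_dur_pos)
    then have exp_le: "exp (- lam * ?h) * e \<le> e" if "e > 0" for e
      using that lam_pos by simp
    show "game_value t lam g q p = Val ?R"
    proof (rule antisym)
      show "Val ?R \<le> game_value t lam g q p"
        proof (rule game_value_geI[OF t p])
        fix e :: real assume e: "e > 0"
        then obtain x where x: "\<And>y. Val ?R - e / 2 \<le> mix x y ?R"
          using Val_lower[where a = ?R and e = "e / 2"] by auto
        have "\<forall>a. \<exists>s. \<forall>\<tau>. game_value (tail_partition t 1) lam g q (?p (fst a) (snd a)) - e / 2
            \<le> expected_payoff (tail_partition t 1) lam g q (?p (fst a) (snd a)) s \<tau>"
          using game_value_lower[OF t' p'] e by simp
        then obtain s where s: "\<And>a \<tau>. game_value (tail_partition t 1) lam g q (?p (fst a) (snd a)) - e / 2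
            \<le> expected_payoff (tail_partition t 1) lam g q (?p (fst a) (snd a)) (s a) \<tau>"
          by metis
        define \<sigma> where "\<sigma> l = (case l of [] \<Rightarrow> x | a # l \<Rightarrow> s a l)" for l
        have \<sigma>: "\<sigma> [] = x" "(\<lambda>l. \<sigma> (a # l)) = s a" for a
          by (simp_all add: \<sigma>_def)
        show "\<exists>\<sigma>. \<forall>\<tau>. Val ?R - e \<le> expected_payoff t lam g q p \<sigma> \<tau>"
        proof (intro exI[of _ \<sigma>] allI)
          fix \<tau> :: "('i, 'j) strategy2"
          have "Val ?R - e \<le> mix x (\<tau> []) ?R + - (e / 2)"
            using x[of "\<tau> []"] by simp
          also have "\<dots> = mix x (\<tau> []) (\<lambda>i j. ?R i j + - (e / 2))"
            by (simp only: mix_add mix_const)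
          also have "\<dots> \<le> expected_payoff t lam g q p \<sigma> \<tau>"
            unfolding expected_payoff_rec[OF t p]
            unfolding \<sigma>
          proof (rule mix_mono)
            fix i j
            have "exp (- lam * ?h) * (game_value (tail_partition t 1) lam g q (?p i j) - e / 2) \<le>
              exp (- lam * ?h) * expected_payoff (tail_partition t 1) lam g q (?p i j) (s (i, j)) (\<lambda>l. \<tau> ((i, j) # l))"
              using s[of "(i, j)"] by (intro mult_left_mono) auto
            then show "?R i j + - (e / 2)
              \<le> ?h * lam * mean_payoff g i j p + exp (- lam * ?h) *
                expected_payoff (tail_partition t 1) lam g q (?p i j) (s (i, j)) (\<lambda>l. \<tau> ((i, j) # l))"
              using exp_le[OF half_gt_zero[OF e]] unfolding right_diff_distrib mult_minus_left by linarith
          qed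
          finally show "Val ?R - e \<le> expected_payoff t lam g q p \<sigma> \<tau>" .
        qed
      qed
      show "game_value t lam g q p \<le> Val ?R"
        proof (rule game_value_leI[OF t p])
        fix e :: real and \<sigma> :: "('i, 'j) strategy1" assume e: "e > 0"
        then obtain y where y: "mix (\<sigma> []) y ?R \<le> Val ?R + e / 2"
          using Val_upper[where a = ?R and e = "e / 2"] by auto
        have "\<forall>a. \<exists>s. expected_payoff (tail_partition t 1) lam g q (?p (fst a) (snd a)) (\<lambda>l. \<sigma> (a # l)) s
            \<le> game_value (tail_partition t 1) lam g q (?p (fst a) (snd a)) + e / 2"
          using game_value_upper[OF t' p'] e by simp
        then obtain s where s: "\<And>a. expected_payoff (tail_partition t 1) lam g q (?p (fst a) (snd a)) (\<lambda>l. \<sigma> (a # l)) (s a)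
            \<le> game_value (tail_partition t 1) lam g q (?p (fst a) (snd a)) + e / 2"
          by metis
        \<comment> \<open>Both \<open>y\<close> and the continuations \<open>s a\<close> were chosen
          in reply to \<open>\<sigma>\<close>, as the order of supremum and infimum permits.\<close>
        define \<tau> where "\<tau> l = (case l of [] \<Rightarrow> y | a # l \<Rightarrow> s a l)" for l
        have \<tau>: "\<tau> [] = y" "(\<lambda>l. \<tau> (a # l)) = s a" for a
          by (simp_all add: \<tau>_def)
        have "expected_payoff t lam g q p \<sigma> \<tau> \<le> mix (\<sigma> []) y (\<lambda>i j. ?R i j + e / 2)"
          unfolding expected_payoff_rec[OF t p]
          unfolding \<tau>
        proof (rule mix_mono)
          fix i j
          have "exp (- lam * ?h) * expected_payoff (tail_partition t 1) lam g q (?p i j) (\<lambda>l. \<sigma> ((i, j) # l)) (s (i, j)) \<le>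
            exp (- lam * ?h) * (game_value (tail_partition t 1) lam g q (?p i j) + e / 2)"
            using s[of "(i, j)"] by (intro mult_left_mono) auto
          then show "?h * lam * mean_payoff g i j p + exp (- lam * ?h) *
              expected_payoff (tail_partition t 1) lam g q (?p i j) (\<lambda>l. \<sigma> ((i, j) # l)) (s (i, j))
            \<le> ?h * lam * mean_payoff g i j p + exp (- lam * ?h) * game_value (tail_partition t 1) lam g q (?p i j) + e / 2"
            using exp_le[OF half_gt_zero[OF e]] unfolding distrib_left mult_minus_left by linarith
        qed
        also have "\<dots> = mix (\<sigma> []) y ?R + e / 2"
          by (simp only: mix_add mix_const)
        also have "\<dots> \<le> Val ?R + e"
          using y by simp
        finally show "\<exists>\<tau>. expected_payoff t lam g q p \<sigma> \<tau> \<le> Val ?R + e" by blast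
      qed
    qed
  next
    fix t and p :: "real ^ 'w" assume t: "fine_partition 1 t" and p: "p \<in> prob_simplex"
    note le = expected_payoff_le[OF t p, unfolded abs_le_iff]
    have "game_value t lam g q p \<le> payoff_bound"
    proof (rule game_value_leI[OF t p])
      fix e :: real and \<sigma> assume "e > 0"
      then show "\<exists>\<tau>. expected_payoff t lam g q p \<sigma> \<tau> \<le> payoff_bound + e"
        using le by (intro exI[of _ undefined]) (smt (verit))
    qed
    moreover have "- payoff_bound \<le> game_value t lam g q p"
      proof (rule game_value_geI[OF t p])
      fix e :: real assume "e > 0"
      then show "\<exists>\<sigma>. \<forall>\<tau>. - payoff_bound - e \<le> expected_payoff t lam g q p \<sigma> \<tau>"
        using le by (intro exI[of _ undefined] allI) (smt (verit))
    qed
    ultimately show "\<bar>game_value t lam g q p\<bar> \<le> payoff_bound" by simp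
  next
    fix t and p p' :: "real ^ 'w"
    assume t: "fine_partition 1 t" and p: "p \<in> prob_simplex" and p': "p' \<in> prob_simplex"
    let ?D = "payoff_bound * norm (p - p')"
    have "game_value t lam g q p - ?D \<le> game_value t lam g q p'"
      proof (rule game_value_geI[OF t p'])
      fix e :: real assume "e > 0"
      then obtain \<sigma> where \<sigma>: "\<And>\<tau>. game_value t lam g q p - e \<le> expected_payoff t lam g q p \<sigma> \<tau>"
        using game_value_lower[OF t p] by blast
      show "\<exists>\<sigma>. \<forall>\<tau>. game_value t lam g q p - ?D - e \<le> expected_payoff t lam g q p' \<sigma> \<tau>"
      proof (intro exI[of _ \<sigma>] allI)
        fix \<tau>
        show "game_value t lam g q p - ?D - e \<le> expected_payoff t lam g q p' \<sigma> \<tau>"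
          using \<sigma>[of \<tau>] expected_payoff_lipschitz[OF t p p', of \<sigma> \<tau>] by linarith
      qed
    qed
    then show "game_value t lam g q p - game_value t lam g q p' \<le> ?D" by simp
  qed
qed

end

text \<open>For \<open>V = Val\<close> the new operator is the inf sup of the matrix game in which
  player 1 minimises, so this is the game seen with opposite signs.\<close>

lemma (in value_family) value_family_dual:
  "value_family (\<lambda>i j \<omega>. - g i j \<omega>) P q lam (\<lambda>a. - V (\<lambda>i j. - a i j)) (\<lambda>t p. - W t p) B"
proof
  fix a b :: "'i \<Rightarrow> 'j \<Rightarrow> real" and c :: real
  show "- V (\<lambda>i j. - a i j) \<le> - V (\<lambda>i j. - b i j)" if "\<And>i j. a i j \<le> b i j"
    using that by (auto intro: mono)
  show "- V (\<lambda>i j. - (a i j + c)) = - V (\<lambda>i j. - a i j) + c"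
    using add_const[of "\<lambda>i j. - a i j" "- c"] by simp
  show "- V (\<lambda>i j. - (c * a i j)) = c * - V (\<lambda>i j. - a i j)" if "c > 0"
    using scale[OF that, of "\<lambda>i j. - a i j"] by simp
next
  fix t and p :: "real ^ 'w" assume *: "fine_partition 1 t" "p \<in> prob_simplex"
  show "- W t p = - V (\<lambda>i j. - (stage_dur t 0 * lam * mean_payoff (\<lambda>i j \<omega>. - g i j \<omega>) i j p +
        exp (- lam * stage_dur t 0) * - W (tail_partition t 1) (p v* transition (stage_dur t 0) i j)))"
    using bellman[OF *] by (simp add: mean_payoff_def sum_negf add.commute)
  show "\<bar>- W t p\<bar> \<le> B" using bounded[OF *] by simp
  show "- W t p - - W t p' \<le> B * norm (p - p')" if "p' \<in> prob_simplex" for p'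
    using lipschitz[OF *(1) that *(2)] by (simp add: norm_minus_commute)
qed

section \<open>Comparison of viscosity sub- and supersolutions\<close>

lemma compact_prob_simplex: "compact (prob_simplex :: (real ^ 'w::finite) set)"
proof -
  have "closed (prob_simplex :: (real ^ 'w) set)"
    unfolding prob_simplex_def Collect_conj_eq Collect_all_eq
    by (intro closed_Int closed_INT ballI closed_Collect_le closed_Collect_eq continuous_intros)
  moreover have "bounded (prob_simplex :: (real ^ 'w) set)"
    by (rule boundedI[OF norm_prob_simplex_le])
  ultimately show ?thesis by (simp add: compact_eq_bounded_closed)
qed

lemma prob_simplex_nonempty: "(prob_simplex :: (real ^ 'w::finite) set) \<noteq> {}"
proof -
  have "axis \<omega> 1 \<in> (prob_simplex :: (real ^ 'w) set)" for \<omega>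
    by (auto simp: prob_simplex_def axis_def)
  then show ?thesis by blast
qed

text \<open>The test functions of the comparison proof: one square penalises the distance of the
  doubled variables, the other makes the extremum strict.\<close>

lemma C1_near_simplex_quadratic:
  "C1_near_simplex (\<lambda>x. a * (norm (x - y))\<^sup>2 + b * (norm (x - c))\<^sup>2)
     (\<lambda>x. (2 * a) *\<^sub>R (x - y) + (2 * b) *\<^sub>R (x - c))"
  unfolding C1_near_simplex_def
proof (intro exI[of _ UNIV] conjI ballI)
  fix x
  show "GDERIV (\<lambda>x. a * (norm (x - y))\<^sup>2 + b * (norm (x - c))\<^sup>2) x
      :> (2 * a) *\<^sub>R (x - y) + (2 * b) *\<^sub>R (x - c)"
    unfolding gderiv_def power2_norm_eq_inner
    by (rule derivative_eq_intros refl)+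
      (auto simp: fun_eq_iff inner_commute algebra_simps)
qed (auto intro!: continuous_intros)

lemma C1_near_simplex_uminus:
  "C1_near_simplex \<psi> D\<psi> \<Longrightarrow> C1_near_simplex (\<lambda>x. - \<psi> x) (\<lambda>x. - D\<psi> x)"
  unfolding C1_near_simplex_def by (blast intro: GDERIV_minus continuous_on_minus)

text \<open>The subtracted square has zero gradient at \<open>x\<close>, so strictness is gained
  without changing the viscosity inequality there.\<close>

lemma strict_local_max_on_quadratic:
  fixes f :: "'a::real_normed_vector \<Rightarrow> real"
  assumes "x \<in> S" "\<And>y. y \<in> S \<Longrightarrow> f y \<le> f x"
  shows "strict_local_max_on S (\<lambda>y. f y - (norm (y - x))\<^sup>2) x"
proof -
  have "f y - (norm (y - x))\<^sup>2 < f x - (norm (x - x))\<^sup>2" if "y \<in> S" "y \<noteq> x" for y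
  proof -
    have "0 < (norm (y - x))\<^sup>2" using that by simp
    then have "f y - (norm (y - x))\<^sup>2 < f x" using assms(2)[OF that(1)] by linarith
    then show ?thesis by simp
  qed
  then show ?thesis
    using assms(1) unfolding strict_local_max_on_def eventually_at_filter
    by (auto intro!: always_eventually)
qed

text \<open>Mean value inequality for \<open>\<psi>\<close> minus its linear part, whose gradient is
  small near \<open>p\<close>. An expansion at \<open>p\<close> alone would not suffice: a Bellman
  step starts at a nearby belief, and the error must be proportional to the length of that
  step.\<close>

lemma strict_differentiability:
  assumes "C1_near_simplex \<psi> D\<psi>" "p \<in> prob_simplex" "e > 0"
  obtains r where "r > 0" "\<And>x y. x \<in> cball p r \<Longrightarrow> y \<in> cball p r \<Longrightarrow>
    \<bar>\<psi> y - \<psi> x - (y - x) \<bullet> D\<psi> p\<bar> \<le> e * norm (y - x)"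
proof -
  obtain U where U: "open U" "prob_simplex \<subseteq> U" "\<And>x. x \<in> U \<Longrightarrow> GDERIV \<psi> x :> D\<psi> x" "continuous_on U D\<psi>"
    using assms(1) unfolding C1_near_simplex_def by blast
  have p: "p \<in> U" using U assms(2) by blast
  obtain r1 where r1: "r1 > 0" "cball p r1 \<subseteq> U"
    using U(1) p open_contains_cball by blast
  obtain r2 where r2: "r2 > 0" "\<And>x. x \<in> U \<Longrightarrow> dist x p < r2 \<Longrightarrow> dist (D\<psi> x) (D\<psi> p) < e"
    using U(4) p assms(3) unfolding continuous_on_iff by blast
  define r where "r = min r1 (r2 / 2)"
  have r: "r > 0" "r \<le> r1" "r < r2" using r1 r2 by (auto simp: r_def)
  show ?thesis
  proof (rule that[OF r(1)])
    fix x y assume xy: "x \<in> cball p r" "y \<in> cball p r"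
    let ?f = "\<lambda>x. \<psi> x - x \<bullet> D\<psi> p"
    have "norm (?f y - ?f x) \<le> e * norm (y - x)"
    proof (rule differentiable_bound[of "cball p r"])
      fix z assume z: "z \<in> cball p r"
      then have "z \<in> U" using r r1(2) by auto
      then have "(\<psi> has_derivative (\<lambda>h. h \<bullet> D\<psi> z)) (at z)"
        using U(3) by (simp add: gderiv_def)
      then have "(?f has_derivative (\<lambda>h. h \<bullet> D\<psi> z - h \<bullet> D\<psi> p)) (at z)"
        by (auto intro!: derivative_eq_intros)
      then show "(?f has_derivative (\<lambda>h. h \<bullet> (D\<psi> z - D\<psi> p))) (at z within cball p r)"
        by (simp add: inner_diff_right has_derivative_at_withinI)
      have "dist z p < r2" using z r(3) by (simp add: dist_commute)
      then have "norm (D\<psi> z - D\<psi> p) \<le> e"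
        using r2(2)[OF \<open>z \<in> U\<close>] by (simp add: dist_norm less_imp_le)
      then have "norm (h \<bullet> (D\<psi> z - D\<psi> p)) \<le> e * norm h" for h
        using Cauchy_Schwarz_ineq2[of h "D\<psi> z - D\<psi> p"] mult_left_mono[of "norm (D\<psi> z - D\<psi> p)" e "norm h"]
        by (simp add: mult.commute)
      then show "onorm (\<lambda>h. h \<bullet> (D\<psi> z - D\<psi> p)) \<le> e"
        using assms(3) by (intro onorm_bound) auto
    qed (use xy in auto)
    then show "\<bar>\<psi> y - \<psi> x - (y - x) \<bullet> D\<psi> p\<bar> \<le> e * norm (y - x)"
      by (simp add: inner_diff_left algebra_simps)
  qed
qed

context value_equation
begin

text \<open>\<open>hamiltonian\<close> with \<open>V\<close> in place of \<open>Val\<close>, so that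
  it also covers the exchanged game.\<close>

definition H :: "real ^ 'w \<Rightarrow> real ^ 'w \<Rightarrow> real" where
  "H p z = V (\<lambda>i j. lam * mean_payoff g i j p + (p v* q i j) \<bullet> z)"

definition subsolution :: "(real ^ 'w \<Rightarrow> real) \<Rightarrow> bool" where
  "subsolution u \<longleftrightarrow> (\<forall>\<psi> D\<psi>. C1_near_simplex \<psi> D\<psi> \<longrightarrow>
     (\<forall>p. strict_local_max_on prob_simplex (\<lambda>x. u x - \<psi> x) p \<longrightarrow> lam * u p \<le> H p (D\<psi> p)))"

definition supersolution :: "(real ^ 'w \<Rightarrow> real) \<Rightarrow> bool" where
  "supersolution u \<longleftrightarrow> (\<forall>\<psi> D\<psi>. C1_near_simplex \<psi> D\<psi> \<longrightarrow>
     (\<forall>p. strict_local_min_on prob_simplex (\<lambda>x. u x - \<psi> x) p \<longrightarrow> H p (D\<psi> p) \<le> lam * u p))"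

lemma linear_data:
  "linear (\<lambda>x. x v* q i j)" "linear (mean_payoff g i j)"
  by (auto simp: linear_iff vector_matrix_mult_def mean_payoff_def vec_eq_iff algebra_simps
      sum.distrib sum_distrib_left)

lemma data_bound:
  obtains C where "C > 0" "\<And>i j x. norm (x v* q i j) \<le> C * norm x"
    "\<And>i j x. \<bar>mean_payoff g i j x\<bar> \<le> C * norm x"
proof -
  have "\<forall>i j. \<exists>C>0. (\<forall>x. norm (x v* q i j) \<le> C * norm x) \<and> (\<forall>x. \<bar>mean_payoff g i j x\<bar> \<le> C * norm x)"
  proof (intro allI)
    fix i j
    obtain C1 C2 where C: "C1 > 0" "\<And>x. norm (x v* q i j) \<le> C1 * norm x"
        "\<And>x. norm (mean_payoff g i j x) \<le> C2 * norm x"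
      using linear_bounded_pos[OF linear_data(1)[of i j]] linear_bounded_pos[OF linear_data(2)[of i j]]
      by metis
    have "norm (x v* q i j) \<le> max C1 C2 * norm x" "\<bar>mean_payoff g i j x\<bar> \<le> max C1 C2 * norm x" for x
      using C(2,3)[of x] mult_right_mono[of C1 "max C1 C2" "norm x"] mult_right_mono[of C2 "max C1 C2" "norm x"]
      by (auto intro: order_trans)
    then show "\<exists>C>0. (\<forall>x. norm (x v* q i j) \<le> C * norm x) \<and> (\<forall>x. \<bar>mean_payoff g i j x\<bar> \<le> C * norm x)"
      using C(1) by (intro exI[of _ "max C1 C2"]) auto
  qed
  then obtain C where C: "\<And>i j. C i j > 0" "\<And>i j x. norm (x v* q i j) \<le> C i j * norm x"
      "\<And>i j x. \<bar>mean_payoff g i j x\<bar> \<le> C i j * norm x"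
    by metis
  define K where "K = Max (range (case_prod C))"
  have K: "C i j \<le> K" for i j
    unfolding K_def by (rule Max_ge) (auto intro: rev_image_eqI[of "(i, j)"])
  then have "C i j * norm x \<le> K * norm x" for i j x by (simp add: mult_right_mono)
  moreover have "K > 0" using C(1) K less_le_trans by blast
  ultimately show ?thesis
    using that[of K] C(2,3) by (meson order_trans)
qed

text \<open>The constant grows linearly in the gradient; for \<open>z = n *\<^sub>R (x - y)\<close>
  this produces exactly the quantity \<open>n * (norm (x - y))\<^sup>2\<close> that doubling of
  variables keeps small.\<close>

lemma H_lipschitz:
  assumes C: "\<And>i j x. norm (x v* q i j) \<le> C * norm x" "\<And>i j x. \<bar>mean_payoff g i j x\<bar> \<le> C * norm x"
  shows "H p z \<le> H p' z + C * (lam + norm z) * norm (p - p')"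
  unfolding H_def
proof (rule le_add)
  fix i j
  have "lam * mean_payoff g i j (p - p') \<le> lam * (C * norm (p - p'))"
    using C(2)[where i = i and j = j and x = "p - p'"] lam_pos by (intro mult_left_mono) auto
  moreover have "((p - p') v* q i j) \<bullet> z \<le> (C * norm (p - p')) * norm z"
    using norm_cauchy_schwarz[of "(p - p') v* q i j" z] C(1)[where i = i and j = j and x = "p - p'"]
      mult_right_mono[of _ _ "norm z"] by (meson norm_ge_zero order_trans)
  ultimately show "lam * mean_payoff g i j p + (p v* q i j) \<bullet> z \<le>
      lam * mean_payoff g i j p' + (p' v* q i j) \<bullet> z + C * (lam + norm z) * norm (p - p')"
    by (simp add: linear_diff[OF linear_data(1)] linear_diff[OF linear_data(2)] inner_diff_left algebra_simps)
qed

text \<open>Doubling of variables: at a maximum \<open>(x, y)\<close> of \<open>u x - w y - n / 2 * norm (x - y)\<^sup>2\<close>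
  both inequalities hold with the same gradient \<open>n *\<^sub>R (x - y)\<close>, and
  \<open>n * norm (x - y)\<^sup>2\<close> is controlled by the modulus of continuity of \<open>u\<close>.\<close>

theorem comparison:
  assumes u: "continuous_on prob_simplex u" "subsolution u"
    and w: "continuous_on prob_simplex w" "supersolution w"
    and p: "p \<in> prob_simplex"
  shows "u p \<le> w p"
proof -
  let ?S = "prob_simplex :: (real ^ 'w) set"
  note S = compact_prob_simplex prob_simplex_nonempty
  obtain m where m: "m \<in> ?S" "\<And>x. x \<in> ?S \<Longrightarrow> u x - w x \<le> u m - w m"
    using continuous_attains_sup[OF S continuous_on_diff[OF u(1) w(1)]] by blast
  define \<theta> where "\<theta> = u m - w m"
  have "\<theta> \<le> 0"
  proof (rule ccontr)
    assume "\<not> \<theta> \<le> 0" then have \<theta>: "\<theta> > 0" by simp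
    obtain C where C: "C > 0" "\<And>i j x. norm (x v* q i j) \<le> C * norm x"
      "\<And>i j x. \<bar>mean_payoff g i j x\<bar> \<le> C * norm x" by (rule data_bound) blast
    obtain M where M: "M > 0" "\<And>x. x \<in> ?S \<Longrightarrow> \<bar>u x\<bar> \<le> M"
      using compact_imp_bounded[OF compact_continuous_image[OF u(1) S(1)]]
      unfolding bounded_pos by auto
    \<comment> \<open>The final estimate is a sum of \<open>C * lam * norm (x - y)\<close> and
      \<open>C * (2 * \<eta>)\<close>. This \<open>\<eta>\<close>, together with
      \<open>d \<le> \<theta> / (4 * C)\<close> below, makes each term at most
      \<open>lam * \<theta> / 4\<close>.\<close>
    define \<eta> where "\<eta> = lam * \<theta> / (8 * C)"
    have \<eta>: "\<eta> > 0" using \<theta> C lam_pos by (simp add: \<eta>_def)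
    obtain d0 where d0: "d0 > 0" "\<And>x y. x \<in> ?S \<Longrightarrow> y \<in> ?S \<Longrightarrow> dist x y < d0 \<Longrightarrow> dist (u x) (u y) < \<eta>"
      using compact_uniformly_continuous[OF u(1) S(1)] \<eta> unfolding uniformly_continuous_on_def by blast
    define d where "d = min d0 (\<theta> / (4 * C))"
    have d: "d > 0" using d0 \<theta> C by (simp add: d_def)
    \<comment> \<open>Large enough that a penalty of at most \<open>2 * M\<close> forces
      \<open>(norm (x - y))\<^sup>2\<close> below half of \<open>d\<^sup>2\<close>.\<close>
    define n where "n = 8 * M / d\<^sup>2"
    have n: "n > 0" using M d by (simp add: n_def)
    let ?f = "\<lambda>z. u (fst z) - w (snd z) - n / 2 * (norm (fst z - snd z))\<^sup>2"
    have "continuous_on (?S \<times> ?S) ?f"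
      by (intro continuous_intros continuous_on_compose2[OF u(1)] continuous_on_compose2[OF w(1)]) auto
    then obtain z where z: "z \<in> ?S \<times> ?S" "\<And>z'. z' \<in> ?S \<times> ?S \<Longrightarrow> ?f z' \<le> ?f z"
      using continuous_attains_sup[OF compact_Times[OF S(1) S(1)], of ?f] S(2) by blast
    obtain x y where xy: "z = (x, y)" by (cases z)
    have xS: "x \<in> ?S" "y \<in> ?S" using z(1) by (auto simp: xy)
    have max: "u x' - w y' - n / 2 * (norm (x' - y'))\<^sup>2 \<le> u x - w y - n / 2 * (norm (x - y))\<^sup>2"
      if "x' \<in> ?S" "y' \<in> ?S" for x' y'
      using z(2)[of "(x', y')"] that by (simp add: xy)
    have ge: "\<theta> + n / 2 * (norm (x - y))\<^sup>2 \<le> u x - w y"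
      using max[OF m(1) m(1)] by (simp add: \<theta>_def)
    \<comment> \<open>Since \<open>u y - w y \<le> \<theta>\<close>, the penalty is at most an
      increment of \<open>u\<close> alone.\<close>
    have pen: "n / 2 * (norm (x - y))\<^sup>2 \<le> u x - u y"
      using ge m(2)[OF xS(2)] by (simp add: \<theta>_def)
    have "n / 2 * (norm (x - y))\<^sup>2 \<le> 2 * M"
      using pen M(2)[OF xS(1)] M(2)[OF xS(2)] by linarith
    then have "(norm (x - y))\<^sup>2 * (2 * M) \<le> d\<^sup>2 * M"
      using d by (simp add: n_def field_simps)
    then have "(norm (x - y))\<^sup>2 * 2 \<le> d\<^sup>2" using M(1) by simp
    then have "(norm (x - y))\<^sup>2 < d\<^sup>2" using d zero_less_power[OF d, of 2] by linarith
    then have lt: "norm (x - y) < d" using d by (meson less_imp_le power_less_imp_less_base)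
    \<comment> \<open>Second pass: with \<open>x\<close> and \<open>y\<close> known to be close,
      uniform continuity of \<open>u\<close> replaces the crude bound \<open>2 * M\<close> on the
      penalty by \<open>\<eta>\<close>.\<close>
    then have "u x - u y < \<eta>"
      using d0(2)[OF xS] by (auto simp: dist_norm d_def)
    with pen have pen': "n * (norm (x - y))\<^sup>2 \<le> 2 * \<eta>" by simp
    let ?z = "n *\<^sub>R (x - y)"
    have sub: "lam * u x \<le> H x ?z"
    proof -
      have "strict_local_max_on ?S (\<lambda>x'. (u x' - n / 2 * (norm (x' - y))\<^sup>2) - (norm (x' - x))\<^sup>2) x"
        by (rule strict_local_max_on_quadratic[OF xS(1)]) (use max[OF _ xS(2)] in auto)
      then have "strict_local_max_on ?S (\<lambda>x'. u x' - (n / 2 * (norm (x' - y))\<^sup>2 + 1 * (norm (x' - x))\<^sup>2)) x"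
        by (simp add: algebra_simps)
      from u(2)[unfolded subsolution_def, rule_format, OF C1_near_simplex_quadratic this]
      show ?thesis by simp
    qed
    have super: "H y ?z \<le> lam * w y"
    proof -
      have "strict_local_max_on ?S (\<lambda>y'. (- w y' - n / 2 * (norm (y' - x))\<^sup>2) - (norm (y' - y))\<^sup>2) y"
        by (rule strict_local_max_on_quadratic[OF xS(2)])
          (use max[OF xS(1)] in \<open>auto simp: norm_minus_commute\<close>)
      then have "strict_local_min_on ?S (\<lambda>y'. w y' - ((- (n / 2)) * (norm (y' - x))\<^sup>2 + (- 1) * (norm (y' - y))\<^sup>2)) y"
        unfolding strict_local_max_on_def strict_local_min_on_def
        by (auto elim!: eventually_mono)
      from w(2)[unfolded supersolution_def, rule_format, OF C1_near_simplex_quadratic this]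
      show ?thesis by (simp add: scaleR_diff_right)
    qed
    have nz: "norm ?z * norm (x - y) = n * (norm (x - y))\<^sup>2"
      using n by (simp add: power2_eq_square)
    have "0 \<le> n / 2 * (norm (x - y))\<^sup>2" using n by simp
    then have "lam * \<theta> \<le> lam * (u x - w y)"
      using ge lam_pos by (intro mult_left_mono) linarith+
    also have "\<dots> \<le> H x ?z - H y ?z" using sub super by (simp add: right_diff_distrib)
    also have "\<dots> \<le> C * (lam + norm ?z) * norm (x - y)"
      using H_lipschitz[OF C(2,3), of x ?z y] by simp
    also have "\<dots> = C * lam * norm (x - y) + C * (n * (norm (x - y))\<^sup>2)"
      unfolding nz[symmetric] by (simp add: algebra_simps)
    also have "\<dots> \<le> C * lam * (\<theta> / (4 * C)) + C * (2 * \<eta>)"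
      using lt pen' C(1) lam_pos by (intro add_mono mult_left_mono) (auto simp: d_def)
    also have "\<dots> = lam * \<theta> / 2"
      using C(1) by (simp add: \<eta>_def field_simps)
    finally show False using mult_pos_pos[OF lam_pos \<theta>] by linarith
  qed
  then show ?thesis using m(2)[OF p] by (simp add: \<theta>_def)
qed

end

section \<open>The limit of vanishing stage duration\<close>

context value_family
begin

text \<open>The limes superior as the mesh tends to 0, taken at each fixed \<open>p\<close>: the
  inner supremum decreases as \<open>d\<close> shrinks, so the infimum is its limit.\<close>

definition upper_limit :: "real ^ 'w \<Rightarrow> real" where
  "upper_limit p = (INF d\<in>{0<..1}. SUP t\<in>{t. fine_partition d t}. W t p)"

lemma
  assumes p: "p \<in> prob_simplex"
  shows upper_limit_attained: "0 < d \<Longrightarrow> d \<le> 1 \<Longrightarrow> e > 0 \<Longrightarrow> \<exists>t. fine_partition d t \<and> upper_limit p - e < W t p"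
    and upper_limit_bound: "e > 0 \<Longrightarrow> \<exists>d. 0 < d \<and> d \<le> 1 \<and> (\<forall>t. fine_partition d t \<longrightarrow> W t p < upper_limit p + e)"
proof -
  let ?s = "\<lambda>d. SUP t\<in>{t. fine_partition d t}. W t p"
  have le: "W t p \<le> B" "- B \<le> W t p" if "fine_partition d t" "d \<le> 1" for d t
    using bounded[OF fine_partition_mono[OF that] p] by auto
  have above: "bdd_above ((\<lambda>t. W t p) ` {t. fine_partition d t})" if "d \<le> 1" for d
    using le that by (intro bdd_aboveI[of _ B]) auto
  have ne: "{t. fine_partition d t} \<noteq> {}" if "0 < d" for d
    using fine_partition_uniform[OF that] by blast
  have "- B \<le> ?s d" if "0 < d" "d \<le> 1" for d
    using le[OF fine_partition_uniform[OF that(1)] that(2)]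
      cSUP_upper[OF _ above[OF that(2)], of "\<lambda>n. d * real n"] fine_partition_uniform[OF that(1)]
    by auto
  then have below: "bdd_below (?s ` {0<..1})"
    by (intro bdd_belowI[of _ "- B"]) auto
  show "\<exists>t. fine_partition d t \<and> upper_limit p - e < W t p" if "0 < d" "d \<le> 1" "e > 0"
  proof -
    have "upper_limit p \<le> ?s d"
      unfolding upper_limit_def by (rule cINF_lower[OF below]) (use that in auto)
    then have "upper_limit p - e < ?s d" using that by simp
    then show ?thesis
      using less_cSUP_iff[OF ne[OF that(1)] above[OF that(2)]] by auto
  qed
  show "\<exists>d. 0 < d \<and> d \<le> 1 \<and> (\<forall>t. fine_partition d t \<longrightarrow> W t p < upper_limit p + e)" if "e > 0"
  proof -
    have "(INF d\<in>{0<..1}. ?s d) < upper_limit p + e"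
      using that by (simp add: upper_limit_def)
    then obtain d where d: "0 < d" "d \<le> 1" "?s d < upper_limit p + e"
      using cINF_less_iff[OF _ below] by auto
    then have "W t p < upper_limit p + e" if "fine_partition d t" for t
      using cSUP_upper[OF _ above, of t d] that by auto
    with d show ?thesis by blast
  qed
qed

lemma B_nonneg: "0 \<le> B"
proof -
  obtain p :: "real ^ 'w" where "p \<in> prob_simplex" using prob_simplex_nonempty by blast
  from bounded[OF fine_partition_uniform[of 1] this] show ?thesis by simp
qed

lemma upper_limit_lipschitz:
  assumes p: "p \<in> prob_simplex" "p' \<in> prob_simplex"
  shows "upper_limit p - upper_limit p' \<le> B * norm (p - p')"
proof (rule field_le_epsilon)
  fix e :: real assume "e > 0"
  then obtain d where d: "0 < d" "d \<le> 1" "\<And>t. fine_partition d t \<Longrightarrow> W t p' < upper_limit p' + e / 2"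
    using upper_limit_bound[OF p(2), of "e / 2"] by auto
  obtain t where t: "fine_partition d t" "upper_limit p - e / 2 < W t p"
    using upper_limit_attained[OF p(1) d(1,2), of "e / 2"] \<open>e > 0\<close> by auto
  from lipschitz[OF fine_partition_mono[OF t(1) d(2)] p] d(3)[OF t(1)] t(2)
  show "upper_limit p - upper_limit p' \<le> B * norm (p - p') + e" by linarith
qed

lemma lipschitz_continuous_on:
  fixes f :: "real ^ 'w \<Rightarrow> real"
  assumes "\<And>p p'. p \<in> S \<Longrightarrow> p' \<in> S \<Longrightarrow> f p - f p' \<le> B * norm (p - p')"
  shows "continuous_on S f"
proof (rule lipschitz_on_continuous_on, rule lipschitz_onI)
  show "dist (f p) (f p') \<le> B * dist p p'" if "p \<in> S" "p' \<in> S" for p p'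
    using assms[of p p'] assms[of p' p] that by (auto simp: dist_norm norm_minus_commute abs_le_iff)
qed (rule B_nonneg)

lemmas continuous_on_upper_limit = lipschitz_continuous_on[OF upper_limit_lipschitz]

text \<open>Pointwise control on a finite net suffices, since every \<open>W t\<close> and the limit
  share the Lipschitz constant \<open>B\<close>. Each of the three comparisons costs
  \<open>e / 3\<close>.\<close>

lemma upper_limit_uniform:
  assumes e: "e > 0"
  shows "\<exists>d. 0 < d \<and> d \<le> 1 \<and>
    (\<forall>t. fine_partition d t \<longrightarrow> (\<forall>p\<in>prob_simplex. W t p \<le> upper_limit p + e))"
proof -
  \<comment> \<open>\<open>B + 1\<close> keeps the quotient meaningful when \<open>B\<close> is
    0.\<close>
  define r where "r = e / (3 * (B + 1))"
  have r: "r > 0" "B * r \<le> e / 3" using e B_nonneg by (auto simp: r_def field_simps)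
  obtain K where K: "finite K" "K \<subseteq> prob_simplex" "(prob_simplex :: (real ^ 'w) set) \<subseteq> (\<Union>k\<in>K. ball k r)"
    using seq_compact_imp_totally_bounded[OF compact_imp_seq_compact[OF compact_prob_simplex[where 'w = 'w]],
        rule_format, OF r(1)] by metis
  have "\<forall>k\<in>K. \<exists>d. 0 < d \<and> d \<le> 1 \<and> (\<forall>t. fine_partition d t \<longrightarrow> W t k < upper_limit k + e / 3)"
    using upper_limit_bound[of _ "e / 3"] K(2) e by auto
  then obtain d where d: "\<And>k. k \<in> K \<Longrightarrow> 0 < d k" "\<And>k. k \<in> K \<Longrightarrow> d k \<le> 1"
      "\<And>k t. k \<in> K \<Longrightarrow> fine_partition (d k) t \<Longrightarrow> W t k < upper_limit k + e / 3"
    by metis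
  define m where "m = Min (insert 1 (d ` K))"
  have fin: "finite (insert 1 (d ` K))" "insert 1 (d ` K) \<noteq> {}" using K(1) by auto
  have m: "0 < m" "m \<le> 1" "\<And>k. k \<in> K \<Longrightarrow> m \<le> d k"
    unfolding m_def using d(1) by (subst Min_gr_iff[OF fin]) (auto intro!: Min_le fin(1))
  show ?thesis
  proof (intro exI[of _ m] conjI allI impI ballI m)
    fix t and p :: "real ^ 'w" assume t: "fine_partition m t" and p: "p \<in> prob_simplex"
    obtain k where k: "k \<in> K" "norm (k - p) < r" using K(3) p by (auto simp: dist_norm)
    have kS: "k \<in> prob_simplex" using k K by auto
    have "B * norm (k - p) \<le> e / 3"
      using mult_left_mono[OF less_imp_le[OF k(2)] B_nonneg] r(2) by linarith
    moreover have "W t p - W t k \<le> B * norm (k - p)"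
      using lipschitz[OF fine_partition_mono[OF t m(2)] p kS] by (simp add: norm_minus_commute)
    moreover have "W t k < upper_limit k + e / 3"
      using d(3)[OF k(1)] fine_partition_mono[OF t m(3)[OF k(1)]] by simp
    moreover note upper_limit_lipschitz[OF kS p]
    ultimately show "W t p \<le> upper_limit p + e" by linarith
  qed
qed

lemma vector_matrix_transition: "p v* transition h i j = p + h *\<^sub>R (p v* q i j)"
  by (simp add: vector_matrix_mult_add_rdistrib vector_scaleR_matrix_ac)

lemma bellman_tail:
  assumes t: "fine_partition 1 t" and p: "p \<in> prob_simplex"
  shows "W (tail_partition t n) p = V (\<lambda>i j. stage_dur t n * lam * mean_payoff g i j p +
    exp (- lam * stage_dur t n) * W (tail_partition t (Suc n)) (p + stage_dur t n *\<^sub>R (p v* q i j)))"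
proof -
  show ?thesis
    using bellman[OF fine_partition_tail[OF t] p, of n]
    by (simp add: stage_dur_tail_partition tail_partition_Suc[of t n] vector_matrix_transition)
qed

lemma next_belief_in_simplex:
  assumes t: "fine_partition 1 t" and p: "p \<in> prob_simplex"
  shows "p + stage_dur t n *\<^sub>R (p v* q i j) \<in> prob_simplex"
proof -
  show ?thesis
    using vector_matrix_prob_simplex[OF p transition_stage_dur[OF t, of n i j]]
    by (simp add: vector_matrix_transition)
qed

text \<open>From \<open>1 - s \<le> exp (- s) \<le> 1 - s + s\<^sup>2\<close>; the signs of
  \<open>a\<close> and \<open>x\<close> are arbitrary, so their bounds enter. It is applied with
  \<open>s = lam * h\<close>, a value \<open>a\<close> and an increment \<open>x\<close> of order
  \<open>h\<close>, which makes both error terms of order \<open>h\<^sup>2\<close>.\<close>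

lemma exp_discount_bound:
  fixes s :: real
  assumes s: "0 \<le> s" and a: "\<bar>a\<bar> \<le> b" and x: "\<bar>x\<bar> \<le> c"
  shows "exp (- s) * (a + x) \<le> (1 - s) * a + x + s\<^sup>2 * b + s * c"
proof -
  have lo: "1 - s \<le> exp (- s)" using exp_ge_add_one_self[of "- s"] by simp
  have "exp (- s) \<le> 1 / (1 + s)"
    using exp_ge_add_one_self[of s] s by (simp add: exp_minus divide_simps)
  also have "\<dots> \<le> 1 - s + s\<^sup>2"
    using s by (simp add: divide_simps power2_eq_square algebra_simps)
  finally have up: "exp (- s) \<le> 1 - s + s\<^sup>2" .
  have "(exp (- s) - (1 - s)) * a \<le> (exp (- s) - (1 - s)) * b"
    using lo a by (intro mult_left_mono) auto
  also have "\<dots> \<le> s\<^sup>2 * b"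
    using up a by (intro mult_right_mono) auto
  finally have 1: "(exp (- s) - (1 - s)) * a \<le> s\<^sup>2 * b" .
  have "(1 - exp (- s)) * (- x) \<le> (1 - exp (- s)) * c"
    using s x by (intro mult_left_mono) auto
  also have "\<dots> \<le> s * c"
    using lo x by (intro mult_right_mono) auto
  finally have 2: "(1 - exp (- s)) * (- x) \<le> s * c" .
  from 1 2 show ?thesis by (simp add: algebra_simps)
qed

text \<open>The penalty \<open>e * t n\<close> makes \<open>W (tail_partition t n) p - \<psi> p - e * t n\<close> attain its maximum
  over all stages \<open>n\<close> and all \<open>p\<close> near the point of contact; one step of the Bellman equation
  at the maximum gives the viscosity inequality with an error proportional to \<open>e\<close>.\<close>

theorem subsolution_upper_limit: "subsolution upper_limit"
  unfolding subsolution_def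
proof (intro allI impI)
  fix \<psi> D\<psi> and c :: "real ^ 'w"
  assume C1: "C1_near_simplex \<psi> D\<psi>"
    and max: "strict_local_max_on prob_simplex (\<lambda>x. upper_limit x - \<psi> x) c"
  let ?S = "prob_simplex :: (real ^ 'w) set"
  let ?u = upper_limit
  let ?z = "D\<psi> c"
  have c: "c \<in> ?S" using max by (simp add: strict_local_max_on_def)
  obtain r0 where r0: "r0 > 0" "\<And>y. y \<in> ?S \<Longrightarrow> y \<noteq> c \<Longrightarrow> dist y c < r0 \<Longrightarrow> ?u y - \<psi> y < ?u c - \<psi> c"
    using max unfolding strict_local_max_on_def eventually_at by auto
  have cont\<psi>: "continuous_on ?S \<psi>"
  proof -
    obtain U where "prob_simplex \<subseteq> U" "\<And>x. x \<in> U \<Longrightarrow> GDERIV \<psi> x :> D\<psi> x"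
      using C1 unfolding C1_near_simplex_def by blast
    then show ?thesis
      by (intro continuous_at_imp_continuous_on ballI) (auto simp: gderiv_def intro: has_derivative_continuous)
  qed
  obtain C where C: "C > 0" "\<And>i j x. norm (x v* q i j) \<le> C * norm x"
    "\<And>i j x. \<bar>mean_payoff g i j x\<bar> \<le> C * norm x" by (rule data_bound) blast
  have Cq: "norm (p v* q i j) \<le> C" if "p \<in> ?S" for p i j
    using C(2)[of p i j] mult_left_le[OF norm_prob_simplex_le[OF that], of C] C(1) by linarith
  \<comment> \<open>\<open>X\<close> bounds the growth rate that appears in \<open>step\<close>
    below; \<open>M\<close> is the coefficient of \<open>h\<^sup>2\<close> that
    \<open>exp_discount_bound\<close> then yields.\<close>
  define X where "X = C * norm ?z + (C + 1)"
  define M where "M = lam\<^sup>2 * B + lam * X"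
  \<comment> \<open>One summand for each source of error of order \<open>e\<close>: the Bellman step
    at the maximum, replacing \<open>p\<close> by \<open>c\<close> in \<open>H\<close>, and
    replacing the value \<open>a\<close> by the limit at \<open>c\<close>.\<close>
  define T where "T = (C + 1 + M) + C * (lam + norm ?z) + lam * (norm ?z + 2)"
  have X: "X > 0" using C(1) by (simp add: X_def add_nonneg_pos)
  have M: "M \<ge> 0" using X B_nonneg lam_pos by (simp add: M_def)
  have T: "T > 0"
  proof -
    have "0 \<le> C * (lam + norm ?z)" "0 \<le> lam * (norm ?z + 2)" using C(1) lam_pos by auto
    then show ?thesis using C(1) M by (simp add: T_def)
  qed
  show "lam * ?u c \<le> H c ?z"
  proof (rule field_le_epsilon)
    fix e0 :: real assume e0: "e0 > 0"
    define e where "e = min 1 (e0 / T)"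
    have e: "e > 0" "e \<le> 1" "e * T \<le> e0"
      using e0 T by (auto simp: e_def min_def field_simps)
    obtain r1 where r1: "r1 > 0" "\<And>x y. x \<in> cball c r1 \<Longrightarrow> y \<in> cball c r1 \<Longrightarrow>
        \<bar>\<psi> y - \<psi> x - (y - x) \<bullet> ?z\<bar> \<le> e * norm (y - x)"
      using strict_differentiability[OF C1 c e(1)] by blast
    \<comment> \<open>Within \<open>r0\<close> the maximum is strict, within \<open>r1\<close> the
      expansion of \<open>\<psi>\<close> holds, and radius \<open>e\<close> makes \<open>p\<close>
      interchangeable with \<open>c\<close> at the end.\<close>
    define r where "r = min (min (r0 / 2) r1) e"
    have r: "r > 0" "r < r0" "r \<le> r1" "r \<le> e" using r0(1) r1(1) e by (auto simp: r_def)
    let ?K = "?S \<inter> cball c r"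
    have K: "compact ?K" "?K \<noteq> {}" using compact_prob_simplex c r by (auto intro: compact_Int)
    have cont: "continuous_on ?K (\<lambda>y. ?u y - \<psi> y)"
      by (intro continuous_on_diff continuous_on_subset[OF cont\<psi>] continuous_on_subset[OF continuous_on_upper_limit]) auto
    let ?A = "?K - ball c (r / 2)"
    have "compact ?A" by (intro compact_diff K) simp
    \<comment> \<open>Compactness turns strictness of the maximum into a gap on the annulus. The gap
      keeps the maximiser in the inner half of the ball, so that one more stage stays inside the
      ball. The annulus may miss the simplex, in which case any gap will do.\<close>
    obtain k where k: "k > 0" "k \<le> e" "\<And>y. y \<in> ?A \<Longrightarrow> ?u y - \<psi> y \<le> ?u c - \<psi> c - 2 * k"
    proof (cases "?A = {}")
      case True
      then have "\<And>y. y \<in> ?A \<Longrightarrow> ?u y - \<psi> y \<le> ?u c - \<psi> c - 2 * e" by blast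
      then show ?thesis using that[OF e(1) order_refl] by blast
    next
      case False
      obtain y0 where y0: "y0 \<in> ?A" "\<And>y. y \<in> ?A \<Longrightarrow> ?u y - \<psi> y \<le> ?u y0 - \<psi> y0"
        using continuous_attains_sup[OF \<open>compact ?A\<close> False continuous_on_subset[OF cont]] by blast
      let ?k = "(?u c - \<psi> c - (?u y0 - \<psi> y0)) / 2"
      have "y0 \<noteq> c" using y0(1) r(1) by auto
      then have "?k > 0" using r0(2)[of y0] y0(1) r by (auto simp: dist_commute)
      then have k: "min ?k e > 0" "min ?k e \<le> e" "min ?k e \<le> ?k"
        using e(1) by (simp_all only: min_less_iff_conj min.cobounded1 min.cobounded2 simp_thms)
      show ?thesis
      proof (rule that[OF k(1,2)])
        fix y assume "y \<in> ?A"
        from y0(2)[OF this] k(3) show "?u y - \<psi> y \<le> ?u c - \<psi> c - 2 * min ?k e" by argo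
      qed
    qed
    obtain d1 where d1: "0 < d1" "d1 \<le> 1" "\<And>t p. fine_partition d1 t \<Longrightarrow> p \<in> ?S \<Longrightarrow> W t p \<le> ?u p + k"
      using upper_limit_uniform[OF k(1)] by blast
    \<comment> \<open>\<open>d1\<close> gives the uniform upper bound, \<open>e\<close> makes the
      second-order error \<open>h * M\<close> at most \<open>e * M\<close>, and the last term limits
      the motion of the belief in one stage to \<open>r / 2\<close>.\<close>
    define d where "d = min (min d1 e) (r / (2 * C))"
    have d: "0 < d" "d \<le> 1" "d \<le> d1" "d \<le> e" "d \<le> r / (2 * C)"
      using d1(1,2) e(1) r(1) C(1) by (auto simp: d_def)
    have dC: "d * C \<le> r / 2" using d(5) C(1) by (simp add: field_simps)
    obtain t where t: "fine_partition d t" "?u c - k < W t c"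
      using upper_limit_attained[OF c d(1,2) k(1)] by blast
    have t1: "fine_partition 1 t" using fine_partition_mono[OF t(1) d(2)] .
    have t0: "t 0 = 0" "strict_mono t" "filterlim t at_top sequentially"
      using t by (auto simp: fine_partition_def time_partition_def)
    have t_nonneg: "0 \<le> t n" for n
      using t0(1) strict_mono_mono[OF t0(2)] by (metis monoD zero_le)
    let ?W = "\<lambda>n. W (tail_partition t n)"
    have tail: "fine_partition d (tail_partition t n)" "fine_partition 1 (tail_partition t n)" for n
      using fine_partition_tail t(1) t1 by auto
    have Wcont: "continuous_on ?S (?W n)" for n
      by (rule lipschitz_continuous_on[OF lipschitz[OF tail(2)]])
    have "\<exists>p\<in>?K. \<forall>p'\<in>?K. ?W n p' - \<psi> p' \<le> ?W n p - \<psi> p" for n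
      by (intro continuous_attains_sup K continuous_on_diff continuous_on_subset[OF cont\<psi>]
          continuous_on_subset[OF Wcont]) auto
    then obtain P where P: "\<And>n. P n \<in> ?K" "\<And>n p'. p' \<in> ?K \<Longrightarrow> ?W n p' - \<psi> p' \<le> ?W n (P n) - \<psi> (P n)"
      by metis
    define f where "f n = ?W n (P n) - \<psi> (P n) - e * t n" for n
    obtain n where n: "\<And>m. f m \<le> f n"
    proof -
      obtain b where b: "\<And>y. y \<in> ?S \<Longrightarrow> - \<psi> y \<le> b"
        using compact_imp_bounded[OF compact_continuous_image[OF cont\<psi> compact_prob_simplex]]
        unfolding bounded_pos by (auto simp: abs_le_iff)
      have fb: "f m \<le> B + b - e * t m" for m
        using bounded[OF tail(2), of "P m" m] b[of "P m"] P(1)[of m] by (auto simp: f_def)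
      have "eventually (\<lambda>m. (B + b - f 0) / e \<le> t m) sequentially"
        using t0(3) by (simp add: filterlim_at_top)
      then obtain N where N: "\<And>m. m \<ge> N \<Longrightarrow> (B + b - f 0) / e \<le> t m"
        by (auto simp: eventually_sequentially)
      \<comment> \<open>Values and \<open>\<psi>\<close> are bounded while the penalty tends to
        infinity, so late stages cannot beat stage 0 and a finite maximum remains.\<close>
      have big: "f m \<le> f 0" if "m \<ge> N" for m
        using fb[of m] N[OF that] e(1) by (simp add: divide_le_eq mult.commute)
      have "finite (f ` {..N})" "f ` {..N} \<noteq> {}" by auto
      then obtain n where n: "n \<le> N" "\<And>m. m \<le> N \<Longrightarrow> f m \<le> f n"
        using Max_in[of "f ` {..N}"] Max_ge[of "f ` {..N}"] by (metis (no_types, lifting) atMost_iff imageE imageI)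
      show ?thesis
      proof (rule that[of n])
        show "f m \<le> f n" for m
          using n(2)[of m] n(2)[of 0] big[of m] by (cases "m \<le> N") auto
      qed
    qed
    define p where "p = P n"
    define a where "a = ?W n p"
    define h where "h = stage_dur t n"
    have p: "p \<in> ?S" "p \<in> ?K" using P(1)[of n] by (auto simp: p_def)
    have h: "0 < h" "h \<le> d"
      using t(1) by (auto simp: h_def fine_partition_def intro: stage_dur_pos)
    have tail0: "tail_partition t 0 = t" by (simp add: fun_eq_iff tail_partition_def t0(1))
    \<comment> \<open>At stage 0 the tail is \<open>t\<close> itself and the penalty vanishes. This
      lower bound and the uniform upper bound for the tail at \<open>n\<close> leave a loss of less
      than \<open>2 * k\<close>, which excludes the annulus.\<close>
    have "?u c - k - \<psi> c < f 0"
      using t(2) P(2)[of c 0] c r(1) by (simp add: f_def t0(1) tail0)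
    also have "\<dots> \<le> f n" by (rule n)
    also have "\<dots> \<le> a - \<psi> p"
      using t_nonneg[of n] e(1) by (simp add: f_def a_def p_def)
    finally have ac: "?u c - k - \<psi> c < a - \<psi> p" .
    have "a \<le> ?u p + k"
      unfolding a_def by (rule d1(3)[OF fine_partition_mono[OF tail(1) d(3)] p(1)])
    with ac have "?u c - \<psi> c - 2 * k < ?u p - \<psi> p" by simp
    then have near: "dist c p \<le> r / 2"
      using k(3)[of p] p(2) by force
    have a: "\<bar>a\<bar> \<le> B" unfolding a_def by (rule bounded[OF tail(2) p(1)])
    \<comment> \<open>Maximality of stage \<open>n\<close> against stage \<open>Suc n\<close>: the
      growth of the penalty contributes \<open>e * h\<close>, the expansion of \<open>\<psi>\<close>
      contributes \<open>e * (h * C)\<close>.\<close>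
    have step: "?W (Suc n) (p + h *\<^sub>R (p v* q i j)) \<le> a + h * ((p v* q i j) \<bullet> ?z) + h * (e * (C + 1))" for i j
    proof -
      let ?p = "p + h *\<^sub>R (p v* q i j)"
      have nle: "norm (?p - p) \<le> h * C"
        using h(1) Cq[OF p(1), of i j] by (simp add: mult_left_mono)
      also have "\<dots> \<le> d * C" using h C(1) by (intro mult_right_mono) auto
      finally have "norm (?p - p) \<le> r / 2" using dC by simp
      then have "dist c ?p \<le> r"
        using near dist_triangle[of c ?p p] by (simp add: dist_norm norm_minus_commute)
      then have pK: "?p \<in> ?K"
        using next_belief_in_simplex[OF t1 p(1), of n i j] by (simp add: h_def)
      have "?W (Suc n) ?p - \<psi> ?p - e * t (Suc n) \<le> f (Suc n)"
        using P(2)[OF pK, of "Suc n"] by (simp add: f_def)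
      also have "\<dots> \<le> a - \<psi> p - e * t n"
        using n[of "Suc n"] by (simp add: f_def[of n] a_def p_def)
      finally have "?W (Suc n) ?p \<le> a + (\<psi> ?p - \<psi> p) + e * h"
        by (simp add: h_def stage_dur_def algebra_simps)
      moreover have "\<psi> ?p - \<psi> p \<le> (?p - p) \<bullet> ?z + e * norm (?p - p)"
        using r1(2)[of p ?p] pK p(2) r(3) by auto
      moreover have "e * norm (?p - p) \<le> e * (h * C)"
        using nle e(1) by (intro mult_left_mono) auto
      ultimately show ?thesis by (simp add: algebra_simps)
    qed
    have "a = V (\<lambda>i j. h * lam * mean_payoff g i j p +
        exp (- lam * h) * ?W (Suc n) (p + h *\<^sub>R (p v* q i j)))"
      unfolding a_def h_def by (rule bellman_tail[OF t1 p(1)])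
    also have "\<dots> \<le> V (\<lambda>i j. h * (lam * mean_payoff g i j p + (p v* q i j) \<bullet> ?z) +
        ((1 - lam * h) * a + h * (e * (C + 1 + M))))"
    proof (rule mono)
      fix i j
      let ?x = "(p v* q i j) \<bullet> ?z + e * (C + 1)"
      have "\<bar>(p v* q i j) \<bullet> ?z\<bar> \<le> C * norm ?z"
        using Cauchy_Schwarz_ineq2[of "p v* q i j" ?z] mult_right_mono[OF Cq[OF p(1), of i j], of "norm ?z"] by simp
      moreover have "e * (C + 1) \<le> 1 * (C + 1)" "0 \<le> e * (C + 1)"
        using e C(1) by (auto intro: mult_right_mono)
      ultimately have "\<bar>?x\<bar> \<le> X" unfolding X_def by simp
      then have x: "\<bar>h * ?x\<bar> \<le> h * X" using h(1) by (simp add: abs_mult mult_left_mono)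
      have "?W (Suc n) (p + h *\<^sub>R (p v* q i j)) \<le> a + h * ?x"
        using step[of i j] unfolding distrib_left[of h] by simp
      then have "exp (- lam * h) * ?W (Suc n) (p + h *\<^sub>R (p v* q i j)) \<le> exp (- (lam * h)) * (a + h * ?x)"
        by simp
      also have "\<dots> \<le> (1 - lam * h) * a + h * ?x + (lam * h)\<^sup>2 * B + (lam * h) * (h * X)"
        using h(1) lam_pos by (intro exp_discount_bound a x) simp
      also have "\<dots> = (1 - lam * h) * a + h * ?x + h * (h * M)"
        by (simp add: M_def power2_eq_square algebra_simps)
      finally have "exp (- lam * h) * ?W (Suc n) (p + h *\<^sub>R (p v* q i j)) \<le>
          (1 - lam * h) * a + h * ?x + h * (h * M)" .
      moreover have "h * (h * M) \<le> h * (e * M)"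
        using h d(4) M by (intro mult_left_mono mult_right_mono) auto
      ultimately show "h * lam * mean_payoff g i j p + exp (- lam * h) * ?W (Suc n) (p + h *\<^sub>R (p v* q i j))
        \<le> h * (lam * mean_payoff g i j p + (p v* q i j) \<bullet> ?z) + ((1 - lam * h) * a + h * (e * (C + 1 + M)))"
        by (simp add: algebra_simps)
    qed
    also have "\<dots> = h * H p ?z + ((1 - lam * h) * a + h * (e * (C + 1 + M)))"
      unfolding add_const H_def by (simp add: scale[OF h(1)])
    \<comment> \<open>The value \<open>a\<close> stands on both sides and cancels except for
      \<open>lam * h * a\<close>; what is left is proportional to \<open>h\<close>.\<close>
    finally have "h * (lam * a) \<le> h * (H p ?z + e * (C + 1 + M))"
      by (simp add: algebra_simps)
    then have la: "lam * a \<le> H p ?z + e * (C + 1 + M)" using h(1) by simp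
    have pc: "norm (p - c) \<le> e" using p(2) r(4) by (simp add: dist_norm norm_minus_commute)
    have "C * (lam + norm ?z) * norm (p - c) \<le> C * (lam + norm ?z) * e"
      using C(1) lam_pos pc by (intro mult_left_mono) auto
    with H_lipschitz[OF C(2,3), of p ?z c] have Hc: "H p ?z \<le> H c ?z + C * (lam + norm ?z) * e"
      by linarith
    have "\<psi> c - \<psi> p \<le> e * (norm ?z + 1)"
    proof -
      have "\<psi> c - \<psi> p \<le> (c - p) \<bullet> ?z + e * norm (c - p)"
        using r1(2)[of p c] p(2) r by auto
      moreover have "(c - p) \<bullet> ?z \<le> e * norm ?z"
        using norm_cauchy_schwarz[of "c - p" ?z] mult_right_mono[OF pc, of "norm ?z"]
        by (simp add: norm_minus_commute)
      moreover have "e * norm (c - p) \<le> e * 1"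
        using pc e by (intro mult_left_mono) (auto simp: norm_minus_commute)
      ultimately show ?thesis by (simp add: algebra_simps)
    qed
    \<comment> \<open>Of the coefficient \<open>norm ?z + 2\<close>, one unit comes from
      \<open>k \<le> e\<close> and the rest from the variation of \<open>\<psi>\<close> between
      \<open>p\<close> and \<open>c\<close>.\<close>
    with ac k(2) have "?u c \<le> a + e * (norm ?z + 2)" by (simp add: algebra_simps)
    then have "lam * ?u c \<le> lam * a + lam * (e * (norm ?z + 2))"
      using lam_pos by (metis distrib_left less_imp_le mult_left_mono)
    also have "\<dots> \<le> H c ?z + e * T"
      using la Hc by (simp add: T_def algebra_simps)
    finally show "lam * ?u c \<le> H c ?z + e0" using e(3) by linarith
  qed
qed

end

section \<open>Exchange of the players and coincidence of the two limits\<close>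

context value_family
begin

interpretation dual: value_family
  "\<lambda>i j \<omega>. - g i j \<omega>" P q lam "\<lambda>a. - V (\<lambda>i j. - a i j)" "\<lambda>t p. - W t p" B
  by (rule value_family_dual)

text \<open>Negation swaps strict minima and maxima and turns the dual Hamiltonian at
  \<open>- z\<close> into \<open>- H p z\<close>. The link between \<open>w\<close> and
  \<open>u\<close> is asked on the simplex only, because the two limits are identified only
  there.\<close>

lemma supersolution_if_dual_subsolution:
  assumes u: "dual.subsolution u" and w: "\<And>p. p \<in> prob_simplex \<Longrightarrow> w p = - u p"
  shows "supersolution w"
  unfolding supersolution_def
proof (intro allI impI)
  fix \<psi> D\<psi> p
  assume C1: "C1_near_simplex \<psi> D\<psi>" and min: "strict_local_min_on prob_simplex (\<lambda>x. w x - \<psi> x) p"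
  have p: "p \<in> prob_simplex" using min by (simp add: strict_local_min_on_def)
  have "strict_local_max_on prob_simplex (\<lambda>x. u x - - \<psi> x) p"
    using min unfolding strict_local_min_on_def strict_local_max_on_def eventually_at_filter
    by (auto simp: w elim!: eventually_mono)
  from u[unfolded dual.subsolution_def, rule_format, OF C1_near_simplex_uminus[OF C1] this]
  have "lam * u p \<le> - H p (D\<psi> p)"
    by (simp add: dual.H_def H_def mean_payoff_def sum_negf add.commute)
  then show "H p (D\<psi> p) \<le> lam * w p" by (simp add: w[OF p])
qed

theorem uniform_limit_exists:
  obtains v where
    "\<And>e. e > 0 \<Longrightarrow> \<exists>d>0. \<forall>t. fine_partition d t \<longrightarrow> (\<forall>p\<in>prob_simplex. \<bar>W t p - v p\<bar> \<le> e)"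
    "continuous_on prob_simplex v" "subsolution v" "supersolution v"
proof
  \<comment> \<open>The limes inferior of the values, as the negative of the limes superior of
    \<open>- W\<close>.\<close>
  let ?l = "\<lambda>p. - dual.upper_limit p"
  have unif: "\<exists>d>0. \<forall>t. fine_partition d t \<longrightarrow>
      (\<forall>p\<in>prob_simplex. W t p \<le> upper_limit p + e \<and> ?l p - e \<le> W t p)" if e: "e > 0" for e
  proof -
    obtain d where d: "0 < d" "\<And>t p. fine_partition d t \<Longrightarrow> p \<in> prob_simplex \<Longrightarrow> W t p \<le> upper_limit p + e"
      using upper_limit_uniform[OF e] by blast
    obtain d' where d': "0 < d'" "\<And>t p. fine_partition d' t \<Longrightarrow> p \<in> prob_simplex \<Longrightarrow> - W t p \<le> dual.upper_limit p + e"
      using dual.upper_limit_uniform[OF e] by blast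
    show ?thesis
    proof (intro exI[of _ "min d d'"] conjI allI impI ballI)
      fix t and p :: "real ^ 'w" assume t: "fine_partition (min d d') t" and p: "p \<in> prob_simplex"
      show "W t p \<le> upper_limit p + e"
        using d(2)[OF fine_partition_mono[OF t] p] by simp
      show "?l p - e \<le> W t p"
        using d'(2)[OF fine_partition_mono[OF t] p] by simp
    qed (use d d' in auto)
  qed
  have eq: "upper_limit p = ?l p" if p: "p \<in> prob_simplex" for p
  proof (rule antisym)
    show "upper_limit p \<le> ?l p"
      by (rule comparison[OF continuous_on_upper_limit subsolution_upper_limit _ _ p])
        (auto intro: continuous_on_minus dual.continuous_on_upper_limit
          supersolution_if_dual_subsolution dual.subsolution_upper_limit)
    \<comment> \<open>The value for one sufficiently fine uniform partition lies between the two
      limits up to \<open>e / 2\<close> on either side.\<close>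
    show "?l p \<le> upper_limit p"
    proof (rule field_le_epsilon)
      fix e :: real assume "e > 0"
      then obtain d where d: "d > 0" "\<And>t. fine_partition d t \<Longrightarrow> W t p \<le> upper_limit p + e / 2 \<and> ?l p - e / 2 \<le> W t p"
        using unif[of "e / 2"] p by auto
      show "?l p \<le> upper_limit p + e"
        using d(2)[OF fine_partition_uniform[OF d(1)]] by linarith
    qed
  qed
  show "continuous_on prob_simplex upper_limit" by (rule continuous_on_upper_limit)
  show "subsolution upper_limit" by (rule subsolution_upper_limit)
  show "supersolution upper_limit"
    by (rule supersolution_if_dual_subsolution[OF dual.subsolution_upper_limit eq])
  fix e :: real assume "e > 0"
  from unif[OF this] eq
  show "\<exists>d>0. \<forall>t. fine_partition d t \<longrightarrow> (\<forall>p\<in>prob_simplex. \<bar>W t p - upper_limit p\<bar> \<le> e)"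
    by (fastforce simp: abs_le_iff)
qed

end

theorem corollary1:
  fixes g :: "'i::finite \<Rightarrow> 'j::finite \<Rightarrow> 'w::finite \<Rightarrow> real"
    and P q :: "'i \<Rightarrow> 'j \<Rightarrow> real ^ 'w ^ 'w"
    and lam :: real
  assumes "\<And>i j. row_stochastic (P i j)"
    and "\<And>i j. q i j = P i j - mat 1"
    and "lam > 0"
  shows "\<exists>v :: real ^ 'w \<Rightarrow> real.
     is_uniform_limit lam g q v \<and>
     continuous_on prob_simplex v \<and> viscosity_solution lam g q v \<and>
     (\<forall>u. continuous_on prob_simplex u \<and> viscosity_solution lam g q u \<longrightarrow>
        (\<forall>p\<in>prob_simplex. u p = v p))"
proof -
  interpret state_blind_game g P q lam
    by unfold_locales (use assms in auto)
  interpret value_family g P q lam Val "\<lambda>t. game_value t lam g q" payoff_bound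
    by (rule value_family_game_value)
  have viscosity: "viscosity_solution lam g q u \<longleftrightarrow> subsolution u \<and> supersolution u" for u
    unfolding viscosity_solution_def subsolution_def supersolution_def H_def hamiltonian_def by blast
  obtain v where v: "\<And>e. e > 0 \<Longrightarrow> \<exists>d>0. \<forall>t. fine_partition d t \<longrightarrow>
        (\<forall>p\<in>prob_simplex. \<bar>game_value t lam g q p - v p\<bar> \<le> e)"
      "continuous_on prob_simplex v" "subsolution v" "supersolution v"
    by (rule uniform_limit_exists) blast
  show ?thesis
  proof (intro exI[of _ v] conjI allI impI ballI)
    show "is_uniform_limit lam g q v"
      using v(1) unfolding is_uniform_limit_def fine_partition_def by blast
    show "viscosity_solution lam g q v" using v by (simp add: viscosity)
    fix u and p :: "real ^ 'w"
    assume "continuous_on prob_simplex u \<and> viscosity_solution lam g q u" and p: "p \<in> prob_simplex"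
    then have u: "continuous_on prob_simplex u" "subsolution u" "supersolution u"
      by (auto simp: viscosity)
    show "u p = v p"
      by (rule antisym; rule comparison[OF _ _ _ _ p]) (rule u v)+
  qed (rule v(2))
qed

end
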